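(* Let $\Sigma=\begin{pmatrix} a&c\\c&b\end{pmatrix}$ be a real symmetric positive semidefinite matrix and let $\widetilde\Sigma=\begin{pmatrix} b&-c\\-c&a\end{pmatrix}$. Let $(f_t)_{t\ge0}$ be a centered $\mathrm{SLE}_\Sigma$ Loewner chain with left and right hulls $L_t,R_t$, and let $(\widetilde f_t)_{t\ge0}$ be a centered $\mathrm{SLE}_{\widetilde\Sigma}$ Loewner chain with left and right hulls $\widetilde L_t,\widetilde R_t$. Then, for each fixed $t>0$, the map $z\mapsto i f_t^{-1}(-iz)$ is equal in law to $\widetilde f_t$. In particular, for each fixed $t>0$, $$\widetilde L_t\overset{d}{=} iR_t\qquad\text{and}\qquad \widetilde R_t\overset{d}{=} iL_t .$$
   Context: **Loewner chains.** For a continuous function $U:[0,\infty)\to\mathbb C$ and $z\in\mathbb C$, let $g_t(z)$ be the solution of $\partial_t g_t(z)=\frac{2}{g_t(z)-U_t}$, $g_0(z)=z$, defined up to its maximal existence time $T_z\in[0,\infty]$ ($T_z=0$ if $z=U_0$). The centered Loewner chain is $f_t(z)=g_t(z)-U_t$. The left hull is $L_t=\{z\in\mathbb C:T_z\le t\}$ and the right hull $R_t$ is the complement of the range of $f_t$, so that $f_t:\mathbb C\setminus L_t\to\mathbb C\setminus R_t$ is a conformal bijection, with inverse $f_t^{-1}:\mathbb C\setminus R_t\to\mathbb C\setminus L_t$. **$\mathrm{SLE}_\Sigma$.** For a positive semidefinite $\Sigma=\begin{pmatrix} a&c\\c&b\end{pmatrix}$, it is the Loewner chain whose driving function $U$ is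 a Brownian motion in $\mathbb C$ started from $0$ with infinitesimal covariance $\Sigma$, i.e. $U_t=\sqrt a\,B_t+i\sqrt b\,\widetilde B_t$ with $B,\widetilde B$ jointly Brownian standard linear Brownian motions, $\operatorname{Cov}(\sqrt a B_t,\sqrt b\widetilde B_t)=ct$. $\overset{d}{=}$ denotes equality in law. *)

theory Defs
  imports "HOL-Probability.Probability"
begin

section \<open>Loewner chains with complex driving functions\<close>

text \<open>
  Driving functions are only looked at on \<open>[0,\<infinity>)\<close>. The condition \<open>g t \<noteq> U t\<close> is needed
  because of the convention \<open>x / 0 = 0\<close>; in particular, for \<open>z = U 0\<close> there is a solution
  only for \<open>T = 0\<close>.
\<close>

definition loewner_solution ::
    "(real \<Rightarrow> complex) \<Rightarrow> complex \<Rightarrow> ereal \<Rightarrow> (real \<Rightarrow> complex) \<Rightarrow> bool" where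
  "loewner_solution U z T g \<longleftrightarrow>
     g 0 = z \<and>
     (\<forall>t. 0 \<le> t \<and> ereal t < T \<longrightarrow>
        g t \<noteq> U t \<and>
        (g has_vector_derivative 2 / (g t - U t)) (at t within {s. 0 \<le> s \<and> ereal s < T}))"

definition loewner_lifetime :: "(real \<Rightarrow> complex) \<Rightarrow> complex \<Rightarrow> ereal" where
  "loewner_lifetime U z = Sup {T. 0 \<le> T \<and> (\<exists>g. loewner_solution U z T g)}"

definition loewner_map :: "(real \<Rightarrow> complex) \<Rightarrow> real \<Rightarrow> complex \<Rightarrow> complex" where
  "loewner_map U t z = (THE w. \<exists>T g. ereal t < T \<and> loewner_solution U z T g \<and> w = g t)"

definition centered_loewner_map :: "(real \<Rightarrow> complex) \<Rightarrow> real \<Rightarrow> (complex \<rightharpoonup> complex)" where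
  "centered_loewner_map U t =
     (\<lambda>z. if ereal t < loewner_lifetime U z then Some (loewner_map U t z - U t) else None)"

definition left_hull :: "(real \<Rightarrow> complex) \<Rightarrow> real \<Rightarrow> complex set" where
  "left_hull U t = {z. loewner_lifetime U z \<le> ereal t}"

definition right_hull :: "(real \<Rightarrow> complex) \<Rightarrow> real \<Rightarrow> complex set" where
  "right_hull U t = - ran (centered_loewner_map U t)"

lemma dom_centered_loewner_map: "dom (centered_loewner_map U t) = - left_hull U t"
  by (auto simp: centered_loewner_map_def left_hull_def dom_def not_le split: if_splits)

text \<open>The inverse of an injective partial map, defined exactly on its range.\<close>

definition map_inverse :: "('a \<rightharpoonup> 'b) \<Rightarrow> ('b \<rightharpoonup> 'a)" where
  "map_inverse f = (\<lambda>w. if w \<in> ran f then Some (THE z. f z = Some w) else None)"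


section \<open>Complex Brownian motion with a given covariance\<close>

definition positive_semidefinite :: "real^2^2 \<Rightarrow> bool" where
  "positive_semidefinite S \<longleftrightarrow> transpose S = S \<and> (\<forall>x. 0 \<le> x \<bullet> (S *v x))"

text \<open>The centered normal law of variance \<open>v \<ge> 0\<close>; for \<open>v = 0\<close> it is the Dirac mass at \<open>0\<close>.\<close>

definition centered_normal :: "real \<Rightarrow> real measure" where
  "centered_normal v =
     (if v = 0 then return borel 0
      else density lborel (\<lambda>x. ennreal (normal_density 0 (sqrt v) x)))"

text \<open>
  The last clause says that the increment \<open>U t - U s\<close>, as a vector of \<open>\<real>\<^sup>2\<close>, is Gaussian with
  covariance matrix \<open>(t - s) S\<close>: every linear functional \<open>x\<close> of it is normal with the
  corresponding variance. The matrix \<open>S\<close> may be degenerate.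
\<close>

definition complex_brownian_motion ::
    "'w measure \<Rightarrow> real^2^2 \<Rightarrow> (real \<Rightarrow> 'w \<Rightarrow> complex) \<Rightarrow> bool" where
  "complex_brownian_motion M S U \<longleftrightarrow>
     prob_space M \<and>
     (\<forall>t\<ge>0. U t \<in> borel_measurable M) \<and>
     (\<forall>\<omega>\<in>space M. continuous_on {0..} (\<lambda>t. U t \<omega>)) \<and>
     (AE \<omega> in M. U 0 \<omega> = 0) \<and>
     (\<forall>(n::nat) (\<tau>::nat \<Rightarrow> real). 0 \<le> \<tau> 0 \<and> (\<forall>i<n. \<tau> i < \<tau> (Suc i)) \<longrightarrow>
        prob_space.indep_vars M (\<lambda>_. borel) (\<lambda>i \<omega>. U (\<tau> (Suc i)) \<omega> - U (\<tau> i) \<omega>) {..<n}) \<and>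
     (\<forall>s t (x::real^2). 0 \<le> s \<and> s < t \<longrightarrow>
        distr M borel (\<lambda>\<omega>. x $ 1 * Re (U t \<omega> - U s \<omega>) + x $ 2 * Im (U t \<omega> - U s \<omega>)) =
          centered_normal ((t - s) * (x \<bullet> (S *v x))))"

text \<open>
  Rescaling the coordinates. With \<open>S = vector [vector [1, r], vector [r, 1]]\<close>, \<open>p = sqrt a\<close>,
  \<open>q = sqrt b\<close> and \<open>p * q * r = c\<close> this is the construction of \<open>U\<close> as \<open>sqrt a B + i sqrt b B'\<close>
  from two jointly Brownian standard linear Brownian motions \<open>B\<close>, \<open>B'\<close>.
\<close>

lemma complex_brownian_motion_scale:
  fixes p q :: real
  assumes "complex_brownian_motion M S W"
  shows "complex_brownian_motion M
           (vector [vector [p * p * S$1$1, p * q * S$1$2], vector [q * p * S$2$1, q * q * S$2$2]])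
           (\<lambda>t \<omega>. complex_of_real p * complex_of_real (Re (W t \<omega>))
                    + \<i> * (complex_of_real q * complex_of_real (Im (W t \<omega>))))"
proof -
  interpret prob_space M using assms by (simp add: complex_brownian_motion_def)
  define h where "h = (\<lambda>w::complex. complex_of_real p * complex_of_real (Re w)
      + \<i> * (complex_of_real q * complex_of_real (Im w)))"
  have hd: "h w - h w' = h (w - w')" for w w' by (simp add: h_def complex_eq_iff algebra_simps)
  have hm[measurable]: "h \<in> borel_measurable borel" unfolding h_def by measurable
  have hc: "continuous_on UNIV h" unfolding h_def by (intro continuous_intros)
  have h0: "h 0 = 0" by (simp add: h_def)
  note A = assms[unfolded complex_brownian_motion_def]
  have 1: "indep_vars (\<lambda>_. borel) (\<lambda>i \<omega>. h (W (\<tau> (Suc i)) \<omega>) - h (W (\<tau> i) \<omega>)) {..<n}"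
    if "0 \<le> \<tau> 0 \<and> (\<forall>i<n. \<tau> i < \<tau> (Suc i))" for n :: nat and \<tau> :: "nat \<Rightarrow> real"
  proof -
    have "indep_vars (\<lambda>_. borel) (\<lambda>i \<omega>. W (\<tau> (Suc i)) \<omega> - W (\<tau> i) \<omega>) {..<n}"
      using A that by blast
    from indep_vars_compose2[OF this, of "\<lambda>_. h" "\<lambda>_. borel"] show ?thesis by (simp add: hd)
  qed
  let ?S = "vector [vector [p * p * S$1$1, p * q * S$1$2],
              vector [q * p * S$2$1, q * q * S$2$2]] :: real^2^2"
  have 2: "distr M borel (\<lambda>\<omega>. x $ 1 * Re (h (W t \<omega>) - h (W s \<omega>)) + x $ 2 * Im (h (W t \<omega>) - h (W s \<omega>))) =
          centered_normal ((t - s) * (x \<bullet> (?S *v x)))" if "0 \<le> s" "s < t" for s t and x :: "real^2"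
  proof -
    define y :: "real^2" where "y = vector [p * x$1, q * x$2]"
    have "x \<bullet> (?S *v x) = y \<bullet> (S *v y)"
      by (simp add: y_def inner_vec_def matrix_vector_mult_def sum_2 algebra_simps)
    moreover have "x $ 1 * Re (h w) + x $ 2 * Im (h w) = y $ 1 * Re w + y $ 2 * Im w" for w
      by (simp add: y_def h_def)
    ultimately show ?thesis using A that by (simp only: hd)
  qed
  have "complex_brownian_motion M ?S (\<lambda>t \<omega>. h (W t \<omega>))"
    unfolding complex_brownian_motion_def
  proof (intro conjI allI impI ballI)
    show "(\<lambda>\<omega>. h (W t \<omega>)) \<in> borel_measurable M" if "0 \<le> t" for t
      using A that by (intro measurable_compose[OF _ hm]) blast
    show "continuous_on {0..} (\<lambda>t. h (W t \<omega>))" if "\<omega> \<in> space M" for \<omega>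
      using A that by (intro continuous_on_compose2[OF hc]) auto
    have "AE \<omega> in M. W 0 \<omega> = 0" using A by blast
    then show "AE \<omega> in M. h (W 0 \<omega>) = 0" using h0 by auto
  qed (use 1 2 prob_space_axioms in blast)+
  then show ?thesis by (simp only: h_def)
qed


section \<open>Equality in law\<close>

text \<open>
  Partial maps that are continuous with open domain, with the Borel sets of the compact-open
  topology (locally uniform convergence, including convergence of the domains from inside).
\<close>

definition partial_map_space :: "(complex \<rightharpoonup> complex) measure" where
  "partial_map_space =
     (let \<Omega> = {f. open (dom f) \<and> continuous_on (dom f) (\<lambda>z. the (f z))}
      in sigma \<Omega> {{f \<in> \<Omega>. K \<subseteq> dom f \<and> (\<lambda>z. the (f z)) ` K \<subseteq> V} | K V. compact K \<and> open V})"

text \<open>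
  Random closed sets: the Effros sigma-algebra, i.e. the Borel sets of the Fell topology.
\<close>

definition closed_set_space :: "complex set measure" where
  "closed_set_space =
     sigma {F. closed F} {{F. closed F \<and> F \<inter> K = {}} | K. compact K}"

text \<open>
  Measurability is part of equality in law, as \<open>distr\<close> is meaningless without it.
\<close>

definition eq_in_law ::
    "'s measure \<Rightarrow> 'w measure \<Rightarrow> ('w \<Rightarrow> 's) \<Rightarrow> 'v measure \<Rightarrow> ('v \<Rightarrow> 's) \<Rightarrow> bool" where
  "eq_in_law E M X N Y \<longleftrightarrow>
     X \<in> measurable M E \<and> Y \<in> measurable N E \<and> distr M E X = distr N E Y"

end

(*
  With W s = i (U (t - s) - U t) for 0 <= s <= t, a solution g of the Loewner equation driven by U
  on [0, t] turns into the solution s |-> i (g (t - s) - U t) of the equation driven by W, because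
  i * i = -1 cancels the sign coming from the reversal of time. Hence the centered map of W at time t
  is z |-> i f^-1 (-i z), up to the translation by i U 0, which vanishes almost surely. On [0, t] the
  process W has independent increments with the Gaussian laws of the rotated covariance, so it has
  the law of V there. Lastly the centered map and the hulls at time t are measurable functionals of
  the path on [0, t]: where a solution keeps a distance d from the driving function it agrees with
  the flow of a bounded Lipschitz field, which is a limit of Euler schemes and depends continuously on z.
*)

theory Submission
  imports Defs
begin

section \<open>Ordinary differential equations with a bounded Lipschitz field\<close>

text \<open>The reversed driver depends on \<open>t\<close>, so the identity concerns each fixed
  time and not the whole process. The main obstacle is that \<open>eq_in_law\<close> demands
  measurability, while the maps and hulls are given by a supremum of lifetimes, a definite
  description and conditions on uncountably many points. The remedy is a margin 1 / (n + 1): for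
  each margin the condition on \<open>z\<close> is closed and can be tested at countably many points
  and times, and a compact subset of the open domain satisfies one margin uniformly. The right hull,
  being the complement of a range, is reached through the left hull of the reversed driver.
  Measurability is required of the map as it stands, so the translation by \<open>i U 0\<close> is
  carried through those proofs and dropped only when laws are compared. The covariance changes as it
  does because - i (x + i y) = y - i x exchanges the variances and flips the sign of the
  covariance.\<close>

lemma at_within_atLeast_eq:
  fixes s T :: real
  assumes "s < T"
  shows "at s within {0..T} = at s within {0..}"
  by (rule at_within_nhd[of _ "{..<T}"]) (use assms in auto)

text \<open>Boundedness of \<open>F\<close> gives the Picard iterates linear growth, which the
  exponential weight turns into boundedness. One fixed point then serves all times, with no gluing
  of local solutions.\<close>

lemma picard_lindelof_global:
  fixes F :: "real \<Rightarrow> 'a::euclidean_space \<Rightarrow> 'a"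
  assumes cont: "continuous_on ({0..} \<times> UNIV) (\<lambda>(s, x). F s x)"
    and lip: "\<And>s x y. 0 \<le> s \<Longrightarrow> norm (F s x - F s y) \<le> L * norm (x - y)"
    and bound: "\<And>s x. 0 \<le> s \<Longrightarrow> norm (F s x) \<le> C"
    and L: "0 < L"
  obtains x where "x 0 = z"
    "\<And>s. 0 \<le> s \<Longrightarrow> (x has_vector_derivative F s (x s)) (at s within {0..})"
proof -
  \<comment> \<open>The unknown is \<open>y r = exp (- 2 L r) x r\<close>: the weight makes the Picard operator a contraction
    for the supremum norm on the whole half-line.\<close>
  define G where "G = (\<lambda>(y :: real \<Rightarrow>\<^sub>C 'a) r. F r (exp (2 * L * r) *\<^sub>R apply_bcontfun y r))"
  define I where "I = (\<lambda>y s. z + integral {0..s} (G y))"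
  \<comment> \<open>\<open>max 0 s\<close> continues the weighted iterate by a constant to negative
    times, as bounded continuous functions are taken on all of \<open>real\<close>.\<close>
  define P where "P = (\<lambda>y s. exp (- (2 * L * max 0 s)) *\<^sub>R I y (max 0 s))"
  have C: "0 \<le> C" using bound[of 0 0] norm_ge_zero order_trans by blast
  have cG: "continuous_on {0..} (G y)" for y
  proof -
    have "continuous_on {0..} (\<lambda>r. (\<lambda>(s, x). F s x) (r, exp (2 * L * r) *\<^sub>R apply_bcontfun y r))"
      by (rule continuous_on_compose2[OF cont]) (auto intro!: continuous_intros)
    then show ?thesis by (simp add: G_def)
  qed
  have cG': "continuous_on {0..s} (G y)" for y s
    by (rule continuous_on_subset[OF cG]) auto
  have dI: "(I y has_vector_derivative G y s) (at s within {0..})" if "0 \<le> s" for y s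
  proof -
    \<comment> \<open>The interval ends beyond \<open>s\<close>, so that the derivative within it is
      also the derivative within the half-line.\<close>
    have "((\<lambda>s. integral {0..s} (G y)) has_vector_derivative G y s) (at s within {0..s+1})"
      by (rule integral_has_vector_derivative[OF cG']) (use that in auto)
    then show ?thesis
      unfolding I_def at_within_atLeast_eq[of s "s+1", simplified]
      by (auto intro!: derivative_eq_intros)
  qed
  have cI: "continuous_on {0..} (I y)" for y
    by (rule continuous_on_vector_derivative) (use dI in auto)
  have P_bcontfun: "P y \<in> bcontfun" for y
  proof (rule bcontfun_normI)
    show "continuous_on UNIV (P y)" unfolding P_def
      by (intro continuous_intros continuous_on_compose2[OF cI]) auto
    fix s :: real
    define r where "r = max 0 s"
    have r: "0 \<le> r" by (simp add: r_def)
    have "norm (integral {0..r} (G y)) \<le> C * (r - 0)"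
      by (rule integral_bound) (use r cG' bound in \<open>auto simp: G_def\<close>)
    then have "norm (I y r) \<le> norm z + C * r"
      unfolding I_def using norm_triangle_ineq[of z] by (smt (verit))
    then have "norm (P y s) \<le> exp (- (2 * L * r)) * (norm z + C * r)"
      unfolding P_def r_def[symmetric] by simp
    also have "\<dots> = exp (- (2 * L * r)) * norm z + C * (exp (- (2 * L * r)) * r)"
      by (simp add: algebra_simps)
    also have "exp (- (2 * L * r)) * norm z \<le> 1 * norm z"
      by (rule mult_right_mono) (use r L in auto)
    also have "exp (- (2 * L * r)) * r \<le> 1 / (2 * L)"
    proof -
      have "2 * L * r \<le> exp (2 * L * r)"
        using exp_ge_add_one_self[of "2 * L * r"] by linarith
      then show ?thesis using L by (simp add: exp_minus field_simps)
    qed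
    finally show "norm (P y s) \<le> 1 * norm z + C * (1 / (2 * L))"
      using C by (simp add: mult_left_mono)
  qed
  define Q where "Q y = Bcontfun (P y)" for y
  have Q: "apply_bcontfun (Q y) = P y" for y
    unfolding Q_def by (rule Bcontfun_inverse[OF P_bcontfun])
  have contraction: "dist (Q y) (Q y') \<le> 1/2 * dist y y'" for y y'
  proof (rule dist_bound)
    fix s :: real
    define r where "r = max 0 s"
    define d where "d = dist y y'"
    have r: "0 \<le> r" by (simp add: r_def)
    \<comment> \<open>The exponent 2 L against the Lipschitz constant L leaves the factor 1/2 in the
      primitive; it is the contraction constant.\<close>
    have "((\<lambda>q. L * d * exp (2 * L * q)) has_integral
             (d / 2 * exp (2 * L * r) - d / 2 * exp (2 * L * 0))) {0..r}"
      by (rule fundamental_theorem_of_calculus[OF r])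
         (auto intro!: derivative_eq_intros simp: has_real_derivative_iff_has_vector_derivative[symmetric])
    then have hi: "((\<lambda>q. L * d * exp (2 * L * q)) has_integral (d / 2 * (exp (2 * L * r) - 1))) {0..r}"
      by (simp add: algebra_simps)
    have "norm (I y r - I y' r) = norm (integral {0..r} (\<lambda>q. G y q - G y' q))"
      unfolding I_def using integrable_continuous_interval[OF cG'] by (simp add: integral_diff)
    also have "\<dots> \<le> integral {0..r} (\<lambda>q. L * d * exp (2 * L * q))"
    proof (rule integral_norm_bound_integral)
      show "(\<lambda>q. G y q - G y' q) integrable_on {0..r}"
        by (intro integrable_continuous_interval continuous_intros cG')
      show "(\<lambda>q. L * d * exp (2 * L * q)) integrable_on {0..r}" using hi by blast
      fix q assume q: "q \<in> {0..r}"
      have "norm (G y q - G y' q)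
          \<le> L * norm (exp (2 * L * q) *\<^sub>R apply_bcontfun y q - exp (2 * L * q) *\<^sub>R apply_bcontfun y' q)"
        unfolding G_def by (rule lip) (use q in auto)
      also have "\<dots> = L * exp (2 * L * q) * dist (apply_bcontfun y q) (apply_bcontfun y' q)"
        by (simp add: dist_norm flip: scaleR_diff_right)
      also have "\<dots> \<le> L * exp (2 * L * q) * d"
        unfolding d_def by (rule mult_left_mono[OF dist_bounded]) (use L in auto)
      finally show "norm (G y q - G y' q) \<le> L * d * exp (2 * L * q)" by (simp add: mult_ac)
    qed
    also have "\<dots> = d / 2 * (exp (2 * L * r) - 1)" using hi by (rule integral_unique)
    finally have "norm (I y r - I y' r) \<le> d / 2 * (exp (2 * L * r) - 1)" .
    then have "exp (- (2 * L * r)) * norm (I y r - I y' r)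
        \<le> exp (- (2 * L * r)) * (d / 2 * (exp (2 * L * r) - 1))"
      by (rule mult_left_mono) auto
    also have "\<dots> = d / 2 * (1 - exp (- (2 * L * r)))"
      by (simp add: algebra_simps exp_minus)
    also have "\<dots> \<le> d / 2 * 1" by (rule mult_left_mono) (auto simp: d_def)
    finally show "dist (apply_bcontfun (Q y) s) (apply_bcontfun (Q y') s) \<le> 1/2 * dist y y'"
      unfolding Q P_def r_def[symmetric] dist_norm d_def scaleR_diff_right[symmetric] by simp
  qed
  have "\<exists>!y\<in>UNIV. Q y = y"
    by (rule Banach_fix[of UNIV "1/2"]) (use contraction in \<open>auto simp: complete_UNIV\<close>)
  then obtain y where y: "Q y = y" by auto
  have yI: "exp (2 * L * s) *\<^sub>R apply_bcontfun y s = I y s" if "0 \<le> s" for s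
    by (subst y[symmetric]) (use that in \<open>simp add: Q P_def flip: exp_add\<close>)
  show ?thesis
  proof (rule that[of "I y"])
    show "I y 0 = z" by (simp add: I_def)
    show "(I y has_vector_derivative F s (I y s)) (at s within {0..})" if "0 \<le> s" for s
      using dI[OF that, of y] yI[OF that] by (simp add: G_def)
  qed
qed

text \<open>The squared distance with the weight \<open>exp (- (2 * L * r))\<close> has nonpositive
  derivative, by Cauchy-Schwarz. The square avoids differentiating the norm at zero.\<close>

lemma gronwall_difference:
  fixes x y :: "real \<Rightarrow> 'a::real_inner"
  assumes x: "\<And>r. r \<in> {0..s} \<Longrightarrow> (x has_vector_derivative x' r) (at r within {0..s})"
    and y: "\<And>r. r \<in> {0..s} \<Longrightarrow> (y has_vector_derivative y' r) (at r within {0..s})"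
    and lip: "\<And>r. r \<in> {0..s} \<Longrightarrow> norm (x' r - y' r) \<le> L * norm (x r - y r)"
    and s: "0 \<le> s"
  shows "norm (x s - y s) \<le> exp (L * s) * norm (x 0 - y 0)"
proof -
  define D where "D = (\<lambda>r. exp (- (2 * L * r)) * ((x r - y r) \<bullet> (x r - y r)))"
  define D' where "D' = (\<lambda>r. 2 * exp (- (2 * L * r)) * ((x r - y r) \<bullet> (x' r - y' r) - L * ((x r - y r) \<bullet> (x r - y r))))"
  have D: "(D has_real_derivative D' r) (at r within {0..s})" if "r \<in> {0..s}" for r
  proof -
    have "((\<lambda>r. x r - y r) has_vector_derivative x' r - y' r) (at r within {0..s})"
      by (intro has_vector_derivative_diff x y that)
    then have "((\<lambda>r. x r - y r) has_derivative (\<lambda>h. h *\<^sub>R (x' r - y' r))) (at r within {0..s})"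
      by (simp add: has_vector_derivative_def)
    from has_derivative_inner[OF this this]
    have "((\<lambda>r. (x r - y r) \<bullet> (x r - y r)) has_real_derivative 2 * ((x r - y r) \<bullet> (x' r - y' r)))
        (at r within {0..s})"
      unfolding has_field_derivative_def
      by (rule has_derivative_eq_rhs) (auto simp: fun_eq_iff inner_commute algebra_simps)
    from DERIV_mult[OF _ this, of "\<lambda>r. exp (- (2 * L * r))" "- 2 * L * exp (- (2 * L * r))"]
    show ?thesis unfolding D_def D'_def
      by (rule DERIV_cong) (auto intro!: derivative_eq_intros simp: algebra_simps)
  qed
  have D'_nonpos: "D' r \<le> 0" if "r \<in> {0..s}" for r
  proof -
    have "(x r - y r) \<bullet> (x' r - y' r) \<le> norm (x r - y r) * norm (x' r - y' r)"
      by (rule norm_cauchy_schwarz)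
    also have "\<dots> \<le> norm (x r - y r) * (L * norm (x r - y r))"
      by (rule mult_left_mono[OF lip[OF that]]) auto
    also have "\<dots> = L * ((x r - y r) \<bullet> (x r - y r))"
      by (simp add: dot_square_norm power2_eq_square)
    finally show ?thesis by (simp add: D'_def mult_nonneg_nonpos)
  qed
  have "D s \<le> D 0"
  proof (rule DERIV_nonpos_imp_decreasing_open[OF s])
    show "continuous_on {0..s} D"
      by (rule DERIV_continuous_on[OF D])
    show "\<exists>y. (D has_real_derivative y) (at r) \<and> y \<le> 0" if "0 < r" "r < s" for r
      using D[of r] D'_nonpos[of r] that by (auto simp: at_within_Icc_at)
  qed
  then have "exp (2 * L * s) * D s \<le> exp (2 * L * s) * D 0" by simp
  then have "(norm (x s - y s))\<^sup>2 \<le> (exp (L * s) * norm (x 0 - y 0))\<^sup>2"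
    by (simp add: D_def dot_square_norm power_mult_distrib exp_double[symmetric] mult.assoc flip: exp_add mult.assoc)
  then show ?thesis by (rule power2_le_imp_le) auto
qed

primrec euler :: "(real \<Rightarrow> 'a::real_vector \<Rightarrow> 'a) \<Rightarrow> 'a \<Rightarrow> real \<Rightarrow> nat \<Rightarrow> 'a" where
  "euler F z h 0 = z"
| "euler F z h (Suc k) = euler F z h k + h *\<^sub>R F (real k * h) (euler F z h k)"

text \<open>Serves measurability: each Euler value is an explicit expression in the field at
  finitely many times, so the solution becomes a limit of such expressions. The local error is
  controlled by uniform continuity of the velocity along the solution, and its accumulation by a
  discrete Gronwall inequality.\<close>

lemma euler_tendsto:
  fixes F :: "real \<Rightarrow> 'a::euclidean_space \<Rightarrow> 'a"
  assumes cont: "continuous_on {0..s} (\<lambda>r. F r (x r))"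
    and lip: "\<And>r x y. 0 \<le> r \<Longrightarrow> norm (F r x - F r y) \<le> L * norm (x - y)"
    and L: "0 < L" and s: "0 \<le> s"
    and x: "\<And>r. r \<in> {0..s} \<Longrightarrow> (x has_vector_derivative F r (x r)) (at r within {0..s})"
  shows "(\<lambda>n. euler F (x 0) (s / real (Suc n)) (Suc n)) \<longlonglongrightarrow> x s"
proof (rule metric_LIMSEQ_I)
  fix e :: real assume e: "0 < e"
  define G where "G = (\<lambda>r. F r (x r))"
  \<comment> \<open>Chosen so that the accumulated error \<epsilon> / L * exp (L s) is e /
    2.\<close>
  define \<epsilon> where "\<epsilon> = e * L / (2 * exp (L * s))"
  have \<epsilon>: "0 < \<epsilon>" using e L by (simp add: \<epsilon>_def)
  have "uniformly_continuous_on {0..s} G"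
    unfolding G_def by (rule compact_uniformly_continuous[OF cont]) auto
  then obtain d where d: "0 < d"
    "\<And>r r'. r \<in> {0..s} \<Longrightarrow> r' \<in> {0..s} \<Longrightarrow> dist r' r < d \<Longrightarrow> dist (G r') (G r) < \<epsilon>"
    using \<epsilon> unfolding uniformly_continuous_on_def by metis
  obtain n0 :: nat where n0: "s / d < real n0" using reals_Archimedean2 by blast
  show "\<exists>no. \<forall>n\<ge>no. dist (euler F (x 0) (s / real (Suc n)) (Suc n)) (x s) < e"
  proof (intro exI[of _ n0] allI impI)
    fix n assume n: "n0 \<le> n"
    define h where "h = s / real (Suc n)"
    have h0: "0 \<le> h" using s by (simp add: h_def)
    have "s / d < real (Suc n)" using n0 n by linarith
    then have hd: "h < d" using d(1) by (simp add: h_def field_simps)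
    have hn: "real (Suc n) * h = s" by (simp add: h_def)
    have step: "norm (x (real (Suc k) * h) - x (real k * h) - h *\<^sub>R G (real k * h)) \<le> h * \<epsilon>"
      if k: "k \<le> n" for k
    proof -
      define p q where "p = real k * h" and "q = real (Suc k) * h"
      have "real (Suc k) * h \<le> real (Suc n) * h" using k h0 by (intro mult_right_mono) auto
      then have qs: "q \<le> s" by (simp only: q_def hn)
      have p0: "0 \<le> p" and pq: "q - p = h" using h0 by (auto simp: p_def q_def algebra_simps)
      have sub: "{p..q} \<subseteq> {0..s}" using p0 qs by auto
      have "norm (x q - x p - (q - p) *\<^sub>R G p) \<le> norm (q - p) * \<epsilon>"
      proof (rule vector_differentiable_bound_linearization)
        show "(x has_vector_derivative G r) (at r within {p..q})" if "r \<in> {p..q}" for r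
          unfolding G_def using x[of r] sub that by (auto intro: has_vector_derivative_within_subset)
        show "closed_segment p q \<subseteq> {p..q}" using pq h0 by (auto simp: closed_segment_eq_real_ivl)
        show "p \<in> {p..q}" using pq h0 by auto
        show "norm (G r - G p) \<le> \<epsilon>" if "r \<in> {p..q}" for r
          using d(2)[of p r] sub that pq h0 hd by (auto simp: dist_norm less_imp_le)
      qed
      then show ?thesis using pq h0 by (simp add: p_def q_def)
    qed
    \<comment> \<open>The right-hand side solves the recursion E (k + 1) = h \<epsilon> + (1 + h L)
      E k with E 0 = 0.\<close>
    have err: "norm (x (real k * h) - euler F (x 0) h k) \<le> \<epsilon> / L * ((1 + h * L) ^ k - 1)"
      if "k \<le> Suc n" for k
      using that
    proof (induction k)
      case 0
      then show ?case by simp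
    next
      case (Suc k)
      define E where "E = euler F (x 0) h k"
      have IH: "norm (x (real k * h) - E) \<le> \<epsilon> / L * ((1 + h * L) ^ k - 1)"
        using Suc by (simp add: E_def)
      have "x (real (Suc k) * h) - euler F (x 0) h (Suc k) =
          (x (real (Suc k) * h) - x (real k * h) - h *\<^sub>R G (real k * h))
          + ((x (real k * h) - E) + h *\<^sub>R (F (real k * h) (x (real k * h)) - F (real k * h) E))"
        by (simp add: E_def G_def algebra_simps)
      also have "norm \<dots> \<le> h * \<epsilon> + (norm (x (real k * h) - E) + h * (L * norm (x (real k * h) - E)))"
      proof -
        have "norm (h *\<^sub>R (F (real k * h) (x (real k * h)) - F (real k * h) E))
            \<le> h * (L * norm (x (real k * h) - E))"
          using h0 by (auto intro!: mult_left_mono lip)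
        moreover have "norm (x (real (Suc k) * h) - x (real k * h) - h *\<^sub>R G (real k * h)) \<le> h * \<epsilon>"
          using Suc by (intro step) simp
        ultimately show ?thesis
          by (intro order_trans[OF norm_triangle_ineq] add_mono order_refl
              order_trans[OF norm_triangle_ineq])
      qed
      also have "\<dots> = h * \<epsilon> + (1 + h * L) * norm (x (real k * h) - E)"
        by (simp add: algebra_simps)
      also have "\<dots> \<le> h * \<epsilon> + (1 + h * L) * (\<epsilon> / L * ((1 + h * L) ^ k - 1))"
        by (intro add_left_mono mult_left_mono IH) (use h0 L in auto)
      also have "\<dots> = \<epsilon> / L * ((1 + h * L) ^ Suc k - 1)"
        using L by (simp add: field_simps)
      finally show ?case .
    qed
    have "norm (x s - euler F (x 0) h (Suc n)) \<le> \<epsilon> / L * ((1 + h * L) ^ Suc n - 1)"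
      using err[of "Suc n"] by (simp only: hn order_refl)
    also have "\<dots> \<le> \<epsilon> / L * exp (L * s)"
    proof (rule mult_left_mono)
      have "(1 + h * L) ^ Suc n \<le> exp (h * L) ^ Suc n"
        by (rule power_mono) (use h0 L in auto)
      also have "\<dots> = exp (L * s)" by (simp only: exp_of_nat_mult[symmetric] hn[symmetric] mult_ac)
      finally show "(1 + h * L) ^ Suc n - 1 \<le> exp (L * s)" by simp
    qed (use \<epsilon> L in auto)
    also have "\<dots> = e / 2" using L by (simp add: \<epsilon>_def)
    finally show "dist (euler F (x 0) (s / real (Suc n)) (Suc n)) (x s) < e"
      using e by (simp add: dist_norm norm_minus_commute h_def)
  qed
qed

section \<open>Deterministic Loewner chains\<close>

text \<open>Written as 2 cnj y / |y|^2, the field 2 / y has its singularity only in the modulus.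
  Replacing |y| by at least \<open>d\<close> there makes it bounded and Lipschitz and leaves it
  unchanged at distance \<open>d\<close> or more from 0.\<close>

definition truncated_field :: "real \<Rightarrow> complex \<Rightarrow> complex" where
  "truncated_field d y = 2 * cnj y / complex_of_real ((max (cmod y) d)\<^sup>2)"

lemma truncated_field_eq:
  assumes "d \<le> cmod y" "y \<noteq> 0"
  shows "truncated_field d y = 2 / y"
proof -
  have "max (cmod y) d = cmod y" using assms by simp
  then have "truncated_field d y = 2 * cnj y / (y * cnj y)"
    unfolding truncated_field_def by (simp only: complex_norm_square)
  then show ?thesis using assms by simp
qed

lemma norm_truncated_field_le:
  assumes "0 < d"
  shows "cmod (truncated_field d y) \<le> 2 / d"
proof -
  have "cmod (truncated_field d y) = 2 * cmod y / (max (cmod y) d)\<^sup>2"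
    by (simp add: truncated_field_def norm_mult norm_divide norm_power)
  also have "\<dots> \<le> 2 * max (cmod y) d / (max (cmod y) d)\<^sup>2"
    by (intro divide_right_mono) auto
  also have "\<dots> = 2 / max (cmod y) d" using assms by (simp add: power2_eq_square)
  also have "\<dots> \<le> 2 / d" using assms by (intro divide_left_mono) auto
  finally show ?thesis .
qed

text \<open>Numerator and denominator are changed one after the other. The first change costs one
  term 1 / d^2, the second costs two, since q^2 - p^2 = (q - p) (q + p) and |y| \<le> q; the factor
  2 of the field makes this 6.\<close>

lemma truncated_field_lipschitz:
  assumes d: "0 < d"
  shows "cmod (truncated_field d x - truncated_field d y) \<le> 6 / d\<^sup>2 * cmod (x - y)"
proof -
  define p q where "p = max (cmod x) d" and "q = max (cmod y) d"
  have p: "d \<le> p" "0 < p" and q: "d \<le> q" "0 < q" using d by (auto simp: p_def q_def)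
  have yq: "cmod y \<le> q" by (simp add: q_def)
  have pq: "\<bar>q - p\<bar> \<le> cmod (x - y)"
    unfolding p_def q_def using norm_triangle_ineq3[of x y] by linarith
  have bound: "1 / (r * r') \<le> 1 / d\<^sup>2" if "d \<le> r" "d \<le> r'" for r r'
    unfolding power2_eq_square using that d by (intro divide_left_mono mult_mono) auto
  have "truncated_field d x - truncated_field d y
      = 2 * (cnj (x - y) / complex_of_real (p\<^sup>2)
           + cnj y * complex_of_real ((q - p) * (q + p) / (p\<^sup>2 * q\<^sup>2)))"
    unfolding truncated_field_def p_def[symmetric] q_def[symmetric]
    using p(2) q(2) by (simp add: divide_simps) (simp add: algebra_simps power2_eq_square)
  also have "cmod \<dots> \<le> 2 * (cmod (cnj (x - y) / complex_of_real (p\<^sup>2))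
      + cmod (cnj y * complex_of_real ((q - p) * (q + p) / (p\<^sup>2 * q\<^sup>2))))"
    by (simp only: norm_mult[of 2] norm_numeral) (intro mult_left_mono norm_triangle_ineq zero_le_numeral)
  also have "cmod (cnj (x - y) / complex_of_real (p\<^sup>2)) = cmod (x - y) * (1 / (p * p))"
    unfolding norm_divide complex_mod_cnj norm_of_real by (simp add: power2_eq_square)
  also have "cmod (cnj y * complex_of_real ((q - p) * (q + p) / (p\<^sup>2 * q\<^sup>2)))
      = cmod y * (\<bar>q - p\<bar> * (q + p) / (p\<^sup>2 * q\<^sup>2))"
    unfolding norm_mult complex_mod_cnj norm_of_real using p(2) q(2) by (simp add: abs_mult)
  also have "cmod y * (\<bar>q - p\<bar> * (q + p) / (p\<^sup>2 * q\<^sup>2)) \<le> q * (cmod (x - y) * (q + p) / (p\<^sup>2 * q\<^sup>2))"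
    by (intro mult_mono divide_right_mono yq pq) (use p q in auto)
  also have "\<dots> = cmod (x - y) * (1 / (p * p) + 1 / (p * q))"
    using p(2) q(2) by (simp add: divide_simps) (simp add: algebra_simps power2_eq_square)
  also have "2 * (cmod (x - y) * (1 / (p * p)) + cmod (x - y) * (1 / (p * p) + 1 / (p * q)))
      \<le> 2 * (cmod (x - y) * (1 / d\<^sup>2) + cmod (x - y) * (1 / d\<^sup>2 + 1 / d\<^sup>2))"
    by (intro mult_left_mono add_mono bound p q) auto
  finally show ?thesis by simp
qed

lemma continuous_on_truncated_field:
  assumes "0 < d" "continuous_on S f"
  shows "continuous_on S (\<lambda>x. truncated_field d (f x))"
  unfolding truncated_field_def
  by (intro continuous_intros assms) (use assms(1) in auto)

text \<open>Defined for every starting point and all times, past any collision with the driver; it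
  is a Loewner solution only as long as the distance \<open>d\<close> has been kept.\<close>

definition loewner_flow :: "real \<Rightarrow> (real \<Rightarrow> complex) \<Rightarrow> complex \<Rightarrow> real \<Rightarrow> complex" where
  "loewner_flow d u z = (SOME x. x 0 = z \<and>
     (\<forall>s\<ge>0. (x has_vector_derivative truncated_field d (x s - u s)) (at s within {0..})))"

lemma loewner_flow:
  assumes d: "0 < d" and u: "continuous_on {0..} u"
  shows loewner_flow_0: "loewner_flow d u z 0 = z"
    and loewner_flow_deriv: "0 \<le> s \<Longrightarrow> (loewner_flow d u z has_vector_derivative
          truncated_field d (loewner_flow d u z s - u s)) (at s within {0..})"
proof -
  define F where "F = (\<lambda>s x. truncated_field d (x - u s))"
  have "continuous_on ({0..} \<times> UNIV) (\<lambda>(s, x). F s x)"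
    unfolding F_def case_prod_beta
    by (intro continuous_on_truncated_field d continuous_intros continuous_on_compose2[OF u]) auto
  moreover have "cmod (F s x - F s y) \<le> 6 / d\<^sup>2 * cmod (x - y)" for s x y
    unfolding F_def using truncated_field_lipschitz[OF d, of "x - u s" "y - u s"] by simp
  moreover have "cmod (F s x) \<le> 2 / d" for s x
    unfolding F_def by (rule norm_truncated_field_le[OF d])
  moreover have "0 < 6 / d\<^sup>2" using d by simp
  ultimately obtain x where "x 0 = z"
    "\<And>s. 0 \<le> s \<Longrightarrow> (x has_vector_derivative F s (x s)) (at s within {0..})"
    using picard_lindelof_global[of F "6 / d\<^sup>2" "2 / d" z] by metis
  then have "\<exists>x. x 0 = z \<and>
      (\<forall>s\<ge>0. (x has_vector_derivative truncated_field d (x s - u s)) (at s within {0..}))"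
    unfolding F_def by blast
  from someI_ex[OF this]
  show "loewner_flow d u z 0 = z" and "0 \<le> s \<Longrightarrow> (loewner_flow d u z has_vector_derivative
          truncated_field d (loewner_flow d u z s - u s)) (at s within {0..})"
    unfolding loewner_flow_def by blast+
qed

lemma continuous_on_loewner_flow:
  assumes "0 < d" "continuous_on {0..} u"
  shows "continuous_on {0..} (loewner_flow d u z)"
  by (rule continuous_on_vector_derivative[OF loewner_flow_deriv[OF assms]]) auto

lemma loewner_flow_lipschitz:
  assumes "0 < d" "continuous_on {0..} u" "0 \<le> s"
  shows "cmod (loewner_flow d u z s - loewner_flow d u z' s) \<le> exp (6 / d\<^sup>2 * s) * cmod (z - z')"
proof -
  note D = has_vector_derivative_within_subset[OF loewner_flow_deriv[OF assms(1,2)]]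
  have "cmod (loewner_flow d u z s - loewner_flow d u z' s)
      \<le> exp (6 / d\<^sup>2 * s) * cmod (loewner_flow d u z 0 - loewner_flow d u z' 0)"
  proof (rule gronwall_difference[OF D D])
    show "cmod (truncated_field d (loewner_flow d u z r - u r) - truncated_field d (loewner_flow d u z' r - u r))
        \<le> 6 / d\<^sup>2 * cmod (loewner_flow d u z r - loewner_flow d u z' r)" for r
      using truncated_field_lipschitz[OF assms(1), of "loewner_flow d u z r - u r" "loewner_flow d u z' r - u r"]
      by simp
  qed (use assms(3) in auto)
  then show ?thesis using assms by (simp add: loewner_flow_0)
qed

lemma loewner_flow_euler:
  assumes d: "0 < d" and u: "continuous_on {0..} u" and s: "0 \<le> s"
  shows "(\<lambda>n. euler (\<lambda>r x. truncated_field d (x - u r)) z (s / real (Suc n)) (Suc n))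
    \<longlonglongrightarrow> loewner_flow d u z s"
proof -
  have "(\<lambda>n. euler (\<lambda>r x. truncated_field d (x - u r)) (loewner_flow d u z 0) (s / real (Suc n)) (Suc n))
    \<longlonglongrightarrow> loewner_flow d u z s"
  proof (rule euler_tendsto[where L = "6 / d\<^sup>2"])
    show "continuous_on {0..s} (\<lambda>r. truncated_field d (loewner_flow d u z r - u r))"
      by (intro continuous_on_truncated_field d continuous_intros)
         (auto intro: continuous_on_subset[OF continuous_on_loewner_flow[OF d u]] continuous_on_subset[OF u])
    show "cmod (truncated_field d (x - u r) - truncated_field d (y - u r)) \<le> 6 / d\<^sup>2 * cmod (x - y)"
      for r x y
      using truncated_field_lipschitz[OF d, of "x - u r" "y - u r"] by simp
    show "(loewner_flow d u z has_vector_derivative truncated_field d (loewner_flow d u z r - u r))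
        (at r within {0..s})" if "r \<in> {0..s}" for r
      using that by (intro has_vector_derivative_within_subset[OF loewner_flow_deriv[OF d u]]) auto
  qed (use d s in auto)
  then show ?thesis by (simp add: loewner_flow_0[OF d u])
qed

section \<open>Solutions on a closed time interval\<close>

text \<open>On a closed interval compactness yields a positive distance from the driver, and time
  reversal maps the interval to itself. The initial value is left free because reversal exchanges it
  with the final one.\<close>

definition solves_loewner_on :: "(real \<Rightarrow> complex) \<Rightarrow> real \<Rightarrow> (real \<Rightarrow> complex) \<Rightarrow> bool" where
  "solves_loewner_on u t g \<longleftrightarrow>
     (\<forall>s\<in>{0..t}. g s \<noteq> u s \<and> (g has_vector_derivative 2 / (g s - u s)) (at s within {0..t}))"

text \<open>The distance to the driver is continuous and nowhere zero on a compact interval, so its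
  minimum is positive. An empty interval admits any bound.\<close>

lemma solves_loewner_on_gap:
  assumes u: "continuous_on {0..} u" and g: "solves_loewner_on u t g"
  shows "\<exists>d>0. \<forall>s\<in>{0..t}. d \<le> cmod (g s - u s)"
proof (cases "0 \<le> t")
  case True
  have "continuous_on {0..t} g"
    by (rule continuous_on_vector_derivative) (use g in \<open>auto simp: solves_loewner_on_def\<close>)
  then have "continuous_on {0..t} (\<lambda>s. cmod (g s - u s))"
    by (intro continuous_intros continuous_on_subset[OF u]) auto
  from continuous_attains_inf[OF _ _ this] True obtain r where
    "r \<in> {0..t}" "\<And>s. s \<in> {0..t} \<Longrightarrow> cmod (g r - u r) \<le> cmod (g s - u s)" by auto
  then show ?thesis using g by (intro exI[of _ "cmod (g r - u r)"]) (auto simp: solves_loewner_on_def)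
next
  case False
  then show ?thesis by (intro exI[of _ 1]) auto
qed

text \<open>The truncation is inactive along \<open>g\<close>, so \<open>g\<close> also solves the
  truncated equation; Gronwall with equal initial values does the rest.\<close>

lemma solves_loewner_on_eq_flow:
  assumes d: "0 < d" and u: "continuous_on {0..} u" and g: "solves_loewner_on u t g"
    and gap: "\<And>s. s \<in> {0..t} \<Longrightarrow> d \<le> cmod (g s - u s)" and s: "s \<in> {0..t}"
  shows "g s = loewner_flow d u (g 0) s"
proof -
  define x where "x = loewner_flow d u (g 0)"
  have sub: "{0..s} \<subseteq> {0..t}" using s by auto
  have "cmod (g s - x s) \<le> exp (6 / d\<^sup>2 * s) * cmod (g 0 - x 0)"
  proof (rule gronwall_difference)
    fix r assume r: "r \<in> {0..s}"
    show "(g has_vector_derivative truncated_field d (g r - u r)) (at r within {0..s})"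
      using g gap[of r] sub r
      by (auto simp: solves_loewner_on_def truncated_field_eq intro!: has_vector_derivative_within_subset[OF _ sub])
    show "(x has_vector_derivative truncated_field d (x r - u r)) (at r within {0..s})"
      unfolding x_def using r
      by (intro has_vector_derivative_within_subset[OF loewner_flow_deriv[OF d u]]) auto
    show "cmod (truncated_field d (g r - u r) - truncated_field d (x r - u r)) \<le> 6 / d\<^sup>2 * cmod (g r - x r)"
      using truncated_field_lipschitz[OF d, of "g r - u r" "x r - u r"] by simp
  qed (use s in auto)
  then show ?thesis by (simp add: x_def loewner_flow_0[OF d u])
qed

lemma loewner_flow_deriv_gap:
  assumes d: "0 < d" and u: "continuous_on {0..} u" and s: "0 \<le> s"
    and gap: "d \<le> cmod (loewner_flow d u z s - u s)"
  shows "loewner_flow d u z s \<noteq> u s"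
    and "(loewner_flow d u z has_vector_derivative 2 / (loewner_flow d u z s - u s)) (at s within {0..})"
proof -
  show *: "loewner_flow d u z s \<noteq> u s" using gap d by auto
  show "(loewner_flow d u z has_vector_derivative 2 / (loewner_flow d u z s - u s)) (at s within {0..})"
    using loewner_flow_deriv[OF d u s, of z] gap * by (simp add: truncated_field_eq)
qed

lemma solves_loewner_on_flow:
  assumes "0 < d" "continuous_on {0..} u"
    and "\<And>s. s \<in> {0..t} \<Longrightarrow> d \<le> cmod (loewner_flow d u z s - u s)"
  shows "solves_loewner_on u t (loewner_flow d u z)"
  unfolding solves_loewner_on_def
proof (intro ballI conjI)
  fix s assume s: "s \<in> {0..t}"
  show "loewner_flow d u z s \<noteq> u s" 
    using loewner_flow_deriv_gap(1)[OF assms(1,2), of s z] assms(3)[OF s] s by auto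
  show "(loewner_flow d u z has_vector_derivative 2 / (loewner_flow d u z s - u s)) (at s within {0..t})"
    using loewner_flow_deriv_gap(2)[OF assms(1,2), of s z] assms(3)[OF s] s
    by (auto intro: has_vector_derivative_within_subset)
qed

text \<open>With the smaller of the two gaps both solutions coincide with one and the same truncated
  flow.\<close>

lemma solves_loewner_on_unique:
  assumes u: "continuous_on {0..} u" and g: "solves_loewner_on u t g" and h: "solves_loewner_on u t h"
    and 0: "g 0 = h 0" and s: "s \<in> {0..t}"
  shows "g s = h s"
proof -
  obtain d where d: "0 < d" "\<And>s. s \<in> {0..t} \<Longrightarrow> d \<le> cmod (g s - u s)"
    using solves_loewner_on_gap[OF u g] by blast
  obtain e where e: "0 < e" "\<And>s. s \<in> {0..t} \<Longrightarrow> e \<le> cmod (h s - u s)"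
    using solves_loewner_on_gap[OF u h] by blast
  define m where "m = min d e"
  have "0 < m" "\<And>s. s \<in> {0..t} \<Longrightarrow> m \<le> cmod (g s - u s)" "\<And>s. s \<in> {0..t} \<Longrightarrow> m \<le> cmod (h s - u s)"
    using d e by (force simp: m_def)+
  then show ?thesis
    using solves_loewner_on_eq_flow[OF _ u g _ s] solves_loewner_on_eq_flow[OF _ u h _ s] 0 by metis
qed

lemma loewner_solution_imp_solves_loewner_on:
  assumes "loewner_solution u z T g" "ereal t < T"
  shows "g 0 = z" "solves_loewner_on u t g"
proof -
  have sub: "{0..t} \<subseteq> {s. 0 \<le> s \<and> ereal s < T}"
    using assms(2) by (auto intro: le_less_trans[of _ "ereal t"])
  show "solves_loewner_on u t g"
    unfolding solves_loewner_on_def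
  proof
    fix s assume "s \<in> {0..t}"
    then have "0 \<le> s \<and> ereal s < T" using sub by blast
    then show "g s \<noteq> u s \<and> (g has_vector_derivative 2 / (g s - u s)) (at s within {0..t})"
      using assms(1) has_vector_derivative_within_subset[OF _ sub]
      unfolding loewner_solution_def by blast
  qed
  show "g 0 = z" using assms(1) by (simp add: loewner_solution_def)
qed

text \<open>The lifetime is a supremum over half-open intervals, so a solution up to and including
  \<open>t\<close> must be shown to survive past \<open>t\<close>. The truncated flow for half the
  gap continues \<open>g\<close>, and by continuity it keeps that half for a short while after
  \<open>t\<close>.\<close>

lemma solves_loewner_on_extend:
  assumes u: "continuous_on {0..} u" and t: "0 \<le> t" and g: "solves_loewner_on u t g"
  obtains T h where "ereal t < T" "loewner_solution u (g 0) T h" "h t = g t"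
proof -
  obtain d where d: "0 < d" "\<And>s. s \<in> {0..t} \<Longrightarrow> d \<le> cmod (g s - u s)"
    using solves_loewner_on_gap[OF u g] by blast
  define e where "e = d / 2"
  have e: "0 < e" "e < d" using d(1) by (auto simp: e_def)
  define x where "x = loewner_flow e u (g 0)"
  have gx: "g s = x s" if "s \<in> {0..t}" for s
    unfolding x_def by (rule solves_loewner_on_eq_flow[OF e(1) u g _ that]) (use d(2) e in force)
  have "continuous_on {0..} (\<lambda>s. cmod (x s - u s))"
    unfolding x_def by (intro continuous_intros continuous_on_loewner_flow e u)
  then have "((\<lambda>s. cmod (x s - u s)) \<longlongrightarrow> cmod (x t - u t)) (at t within {0..})"
    using t by (auto simp: continuous_on_def)
  then have "\<forall>\<^sub>F s in at t within {0..}. e < cmod (x s - u s)"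
    by (rule order_tendstoD) (use d(2)[of t] gx[of t] t e in auto)
  then obtain \<epsilon> where \<epsilon>: "0 < \<epsilon>"
    "\<And>s. 0 \<le> s \<Longrightarrow> s \<noteq> t \<Longrightarrow> dist s t < \<epsilon> \<Longrightarrow> e < cmod (x s - u s)"
    unfolding eventually_at by auto
  have gap: "e \<le> cmod (x s - u s)" if "0 \<le> s" "s < t + \<epsilon>" for s
  proof (cases "s \<le> t")
    case True
    then show ?thesis using d(2)[of s] gx[of s] that e by auto
  next
    case False
    then show ?thesis using \<epsilon>(2)[of s] that by (auto simp: dist_real_def)
  qed
  have "loewner_solution u (g 0) (ereal (t + \<epsilon>)) x"
    unfolding loewner_solution_def
  proof (intro conjI allI impI)
    show "x 0 = g 0" by (simp add: x_def loewner_flow_0[OF e(1) u])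
    fix s assume s: "0 \<le> s \<and> ereal s < ereal (t + \<epsilon>)"
    show "x s \<noteq> u s" "(x has_vector_derivative 2 / (x s - u s)) (at s within {s. 0 \<le> s \<and> ereal s < ereal (t + \<epsilon>)})"
      using loewner_flow_deriv_gap[OF e(1) u, of s "g 0"] gap[of s] s
      by (auto simp: x_def intro: has_vector_derivative_within_subset)
  qed
  then show ?thesis using \<epsilon>(1) gx[of t] t by (intro that[of "ereal (t + \<epsilon>)" x]) auto
qed

lemma less_loewner_lifetime_iff:
  assumes u: "continuous_on {0..} u" and t: "0 \<le> t"
  shows "ereal t < loewner_lifetime u z \<longleftrightarrow> (\<exists>g. g 0 = z \<and> solves_loewner_on u t g)"
proof
  assume "ereal t < loewner_lifetime u z"
  then obtain T g where "ereal t < T" "loewner_solution u z T g"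
    unfolding loewner_lifetime_def less_Sup_iff by auto
  then show "\<exists>g. g 0 = z \<and> solves_loewner_on u t g"
    using loewner_solution_imp_solves_loewner_on by blast
next
  assume "\<exists>g. g 0 = z \<and> solves_loewner_on u t g"
  then obtain g where g: "g 0 = z" "solves_loewner_on u t g" by blast
  obtain T h where T: "ereal t < T" "loewner_solution u z T h"
    using solves_loewner_on_extend[OF u t g(2)] g(1) by blast
  moreover have "0 \<le> T" using T(1) t by (metis ereal_less_eq(5) less_imp_le order_trans)
  ultimately show "ereal t < loewner_lifetime u z"
    unfolding loewner_lifetime_def less_Sup_iff by blast
qed

lemma loewner_map_eq:
  assumes u: "continuous_on {0..} u" and t: "0 \<le> t" and g: "solves_loewner_on u t g"
  shows "loewner_map u t (g 0) = g t"
  unfolding loewner_map_def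
proof (rule the_equality)
  show "\<exists>T h. ereal t < T \<and> loewner_solution u (g 0) T h \<and> g t = h t"
    using solves_loewner_on_extend[OF u t g] by metis
  fix w assume "\<exists>T h. ereal t < T \<and> loewner_solution u (g 0) T h \<and> w = h t"
  then show "w = g t"
    using loewner_solution_imp_solves_loewner_on solves_loewner_on_unique[OF u _ g] t by force
qed

text \<open>Replaces the supremum of lifetimes and the definite description by the existence of a
  solution on \<open>{0..t}\<close>; later arguments start from this form.\<close>

lemma centered_loewner_map_eq_Some_iff:
  assumes u: "continuous_on {0..} u" and t: "0 \<le> t"
  shows "centered_loewner_map u t z = Some w \<longleftrightarrow>
    (\<exists>g. g 0 = z \<and> solves_loewner_on u t g \<and> w = g t - u t)"
proof
  assume "centered_loewner_map u t z = Some w"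
  then have *: "ereal t < loewner_lifetime u z" "w = loewner_map u t z - u t"
    by (auto simp: centered_loewner_map_def split: if_splits)
  then obtain g where "g 0 = z" "solves_loewner_on u t g" using less_loewner_lifetime_iff[OF u t] by blast
  then show "\<exists>g. g 0 = z \<and> solves_loewner_on u t g \<and> w = g t - u t"
    using *(2) loewner_map_eq[OF u t] by metis
next
  assume "\<exists>g. g 0 = z \<and> solves_loewner_on u t g \<and> w = g t - u t"
  then show "centered_loewner_map u t z = Some w"
    using less_loewner_lifetime_iff[OF u t] loewner_map_eq[OF u t]
    by (force simp: centered_loewner_map_def)
qed

section \<open>Margins that exhaust the domain\<close>

text \<open>Stated through the truncated flow, which exists for every \<open>z\<close>, so that no
  existence of a Loewner solution is presupposed and the condition is closed in
  \<open>z\<close>.\<close>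

definition gap_set :: "real \<Rightarrow> (real \<Rightarrow> complex) \<Rightarrow> real \<Rightarrow> complex set" where
  "gap_set d u t = {z. \<forall>s\<in>{0..t}. d \<le> cmod (loewner_flow d u z s - u s)}"

lemma centered_loewner_map_gap_set:
  assumes "0 < d" "continuous_on {0..} u" "0 \<le> t" "z \<in> gap_set d u t"
  shows "centered_loewner_map u t z = Some (loewner_flow d u z t - u t)"
  unfolding centered_loewner_map_eq_Some_iff[OF assms(2,3)]
  using assms solves_loewner_on_flow[OF assms(1,2)] loewner_flow_0[OF assms(1,2)]
  by (intro exI[of _ "loewner_flow d u z"]) (auto simp: gap_set_def)

text \<open>At distance at least \<open>d\<close> neither truncation acts, so lowering the threshold
  leaves the trajectory unchanged.\<close>

lemma loewner_flow_gap_set: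
  assumes d: "0 < d" and u: "continuous_on {0..} u" and z: "z \<in> gap_set d u t"
    and e: "0 < e" "e \<le> d" and s: "s \<in> {0..t}"
  shows "loewner_flow d u z s = loewner_flow e u z s"
proof -
  have gap: "d \<le> cmod (loewner_flow d u z r - u r)" if "r \<in> {0..t}" for r
    using z that by (simp add: gap_set_def)
  have "loewner_flow d u z s = loewner_flow e u (loewner_flow d u z 0) s"
    by (rule solves_loewner_on_eq_flow[OF e(1) u solves_loewner_on_flow[OF d u gap] order_trans[OF e(2) gap] s])
  then show ?thesis by (simp add: loewner_flow_0[OF d u])
qed

lemma gap_set_antimono:
  assumes "0 < e" "e \<le> d" "continuous_on {0..} u"
  shows "gap_set d u t \<subseteq> gap_set e u t"
proof
  fix z assume z: "z \<in> gap_set d u t"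
  have "e \<le> cmod (loewner_flow e u z s - u s)" if s: "s \<in> {0..t}" for s
  proof -
    have "d \<le> cmod (loewner_flow d u z s - u s)" using z s by (simp add: gap_set_def)
    moreover have "loewner_flow d u z s = loewner_flow e u z s"
      by (rule loewner_flow_gap_set[OF _ assms(3) z assms(1,2) s]) (use assms in linarith)
    ultimately show ?thesis using assms(2) by simp
  qed
  then show "z \<in> gap_set e u t" by (simp add: gap_set_def)
qed

text \<open>
  A single index \<open>n\<close> controls both the distance from the driving function and the distance of the
  image from the complement of \<open>V\<close>; this makes the sets increasing in \<open>n\<close>, so that a compact
  set covered by their interiors lies in one of them.
\<close>

definition controlled_set :: "(real \<Rightarrow> complex) \<Rightarrow> real \<Rightarrow> complex \<Rightarrow> complex set \<Rightarrow> nat \<Rightarrow> complex set" where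
  "controlled_set u t v V n =
     {z \<in> gap_set (1 / real (Suc n)) u t.
        ball (loewner_flow (1 / real (Suc n)) u z t - u t + v) (1 / real (Suc n)) \<subseteq> V}"

lemma controlled_set_mono:
  assumes u: "continuous_on {0..} u" and t: "0 \<le> t" and "m \<le> n"
  shows "controlled_set u t v V m \<subseteq> controlled_set u t v V n"
proof
  fix z assume z: "z \<in> controlled_set u t v V m"
  define d e where "d = 1 / real (Suc m)" and "e = 1 / real (Suc n)"
  have de: "0 < d" "0 < e" "e \<le> d" using \<open>m \<le> n\<close> by (auto simp: d_def e_def field_simps)
  have zd: "z \<in> gap_set d u t" using z by (simp add: controlled_set_def d_def)
  then have "z \<in> gap_set e u t" using gap_set_antimono[OF de(2,3) u] by blast
  moreover have "loewner_flow d u z t = loewner_flow e u z t"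
    by (rule loewner_flow_gap_set[OF de(1) u zd de(2,3)]) (use t in auto)
  moreover have "ball (loewner_flow d u z t - u t + v) d \<subseteq> V"
    using z by (simp add: controlled_set_def d_def)
  ultimately show "z \<in> controlled_set u t v V n"
    unfolding controlled_set_def e_def[symmetric] using subset_ball[OF de(3)] by fastforce
qed

lemma controlled_set_subset:
  assumes u: "continuous_on {0..} u" and t: "0 \<le> t" and z: "z \<in> controlled_set u t v V n"
  shows "\<exists>w. centered_loewner_map u t z = Some w \<and> w + v \<in> V"
proof -
  define d where "d = 1 / real (Suc n)"
  have d: "0 < d" by (simp add: d_def)
  have "z \<in> gap_set d u t" "ball (loewner_flow d u z t - u t + v) d \<subseteq> V"
    using z by (auto simp: controlled_set_def d_def)
  then show ?thesis
    using centered_loewner_map_gap_set[OF d u t] d centre_in_ball by blast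
qed

text \<open>The margins of a point, its gap and the distance of its image from the complement of
  \<open>V\<close>, survive small changes of \<open>z\<close>, because the truncated flow is
  Lipschitz in the starting point uniformly over \<open>{0..t}\<close>.\<close>

lemma in_interior_controlled_set:
  assumes u: "continuous_on {0..} u" and t: "0 \<le> t" and V: "open V"
    and z: "centered_loewner_map u t z = Some w" "w + v \<in> V"
  shows "\<exists>n. z \<in> interior (controlled_set u t v V n)"
proof -
  obtain g where g: "g 0 = z" "solves_loewner_on u t g" "w = g t - u t"
    using z(1) centered_loewner_map_eq_Some_iff[OF u t] by auto
  obtain d where d: "0 < d" "\<And>s. s \<in> {0..t} \<Longrightarrow> d \<le> cmod (g s - u s)"
    using solves_loewner_on_gap[OF u g(2)] by blast
  obtain r where r: "0 < r" "ball (w + v) r \<subseteq> V" using V z(2) open_contains_ball by blast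
  \<comment> \<open>Half of each margin pays for moving \<open>z\<close>; the other half is the
    margin that \<open>controlled_set\<close> asks for.\<close>
  obtain n where n: "1 / real (Suc n) < min d r / 2"
    using d r nat_approx_posE[of "min d r / 2"] by auto
  define e where "e = 1 / real (Suc n)"
  have e: "0 < e" "2 * e \<le> d" "2 * e \<le> r" using n by (auto simp: e_def)
  have gflow: "g s = loewner_flow e u z s" if "s \<in> {0..t}" for s
  proof -
    have "e \<le> cmod (g s - u s)" if "s \<in> {0..t}" for s using d(2)[OF that] e by linarith
    then show ?thesis using solves_loewner_on_eq_flow[OF e(1) u g(2) _ that] g(1) by simp
  qed
  define c where "c = exp (6 / e\<^sup>2 * t)"
  have c: "0 < c" by (simp add: c_def)
  \<comment> \<open>\<open>c\<close> bounds the Lipschitz constants of the flow up to time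
    \<open>t\<close>, so trajectories from this ball stay closer than \<open>e\<close> to
    \<open>g\<close>.\<close>
  have "ball z (e / c) \<subseteq> controlled_set u t v V n"
  proof
    fix z' assume z': "z' \<in> ball z (e / c)"
    have near: "dist (loewner_flow e u z' s) (g s) < e" if s: "s \<in> {0..t}" for s
    proof -
      have "cmod (loewner_flow e u z' s - loewner_flow e u z s) \<le> exp (6 / e\<^sup>2 * s) * cmod (z' - z)"
        by (rule loewner_flow_lipschitz[OF e(1) u]) (use s in auto)
      also have "\<dots> \<le> c * cmod (z' - z)"
        unfolding c_def using s by (intro mult_right_mono) (auto intro!: divide_right_mono mult_left_mono)
      also have "\<dots> < e" using z' c by (simp add: dist_norm norm_minus_commute field_simps)
      finally show ?thesis by (simp add: dist_norm gflow[OF s])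
    qed
    have "z' \<in> gap_set e u t"
      unfolding gap_set_def
    proof safe
      fix s assume s: "s \<in> {0..t}"
      have "cmod (g s - u s) \<le> cmod (loewner_flow e u z' s - u s) + dist (loewner_flow e u z' s) (g s)"
        using norm_triangle_ineq[of "loewner_flow e u z' s - u s" "g s - loewner_flow e u z' s"]
        by (simp add: dist_norm norm_minus_commute)
      then show "e \<le> cmod (loewner_flow e u z' s - u s)"
        using near[OF s] d(2)[OF s] e by linarith
    qed
    moreover have "ball (loewner_flow e u z' t - u t + v) e \<subseteq> ball (w + v) r"
    proof
      fix y assume "y \<in> ball (loewner_flow e u z' t - u t + v) e"
      then have "dist (loewner_flow e u z' t) (y - v + u t) < e"
        by (simp add: dist_norm algebra_simps)
      then have "dist (g t) (y - v + u t) < e + e"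
        using near[of t] t dist_triangle3[of "g t" "y - v + u t" "loewner_flow e u z' t"] by auto
      then show "y \<in> ball (w + v) r" using e(3) by (simp add: g(3) dist_norm algebra_simps)
    qed
    ultimately show "z' \<in> controlled_set u t v V n"
      unfolding controlled_set_def e_def[symmetric] using r(2) by blast
  qed
  then show ?thesis using e c by (meson centre_in_ball divide_pos_pos interiorI open_ball)
qed

text \<open>Turns the open condition that defines the compact-open topology into a countable union
  of closed ones.\<close>

lemma compact_subset_controlled_iff:
  assumes u: "continuous_on {0..} u" and t: "0 \<le> t" and V: "open V" and K: "compact K"
  shows "(\<forall>z\<in>K. \<exists>w. centered_loewner_map u t z = Some w \<and> w + v \<in> V) \<longleftrightarrow>
    (\<exists>n. K \<subseteq> controlled_set u t v V n)"
proof
  assume *: "\<forall>z\<in>K. \<exists>w. centered_loewner_map u t z = Some w \<and> w + v \<in> V"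
  have "K \<subseteq> (\<Union>n\<in>UNIV. interior (controlled_set u t v V n))"
  proof
    fix z assume "z \<in> K"
    then obtain w where "centered_loewner_map u t z = Some w" "w + v \<in> V" using * by blast
    from in_interior_controlled_set[OF u t V this]
    show "z \<in> (\<Union>n\<in>UNIV. interior (controlled_set u t v V n))" by blast
  qed
  from compactE_image[OF K _ this] obtain I where I: "finite I"
    "K \<subseteq> (\<Union>n\<in>I. interior (controlled_set u t v V n))" by auto
  \<comment> \<open>The 0 is inserted because \<open>I\<close> is empty when \<open>K\<close>
    is.\<close>
  have "interior (controlled_set u t v V n) \<subseteq> controlled_set u t v V (Max (insert 0 I))" if "n \<in> I" for n
    using controlled_set_mono[OF u t, of n "Max (insert 0 I)"] interior_subset I(1) that by (metis Max_ge finite.insertI insertI2 order_trans)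
  then show "\<exists>n. K \<subseteq> controlled_set u t v V n" using I(2) by blast
next
  assume "\<exists>n. K \<subseteq> controlled_set u t v V n"
  then show "\<forall>z\<in>K. \<exists>w. centered_loewner_map u t z = Some w \<and> w + v \<in> V"
    using controlled_set_subset[OF u t] by blast
qed

text \<open>With \<open>V = UNIV\<close> a controlled set expresses the gap alone. On its interior
  the map is a truncated flow minus a constant, hence Lipschitz.\<close>

lemma
  assumes u: "continuous_on {0..} u" and t: "0 \<le> t"
  shows open_dom_centered_loewner_map: "open (dom (centered_loewner_map u t))"
    and continuous_on_centered_loewner_map:
      "continuous_on (dom (centered_loewner_map u t)) (\<lambda>z. the (centered_loewner_map u t z))"
proof -
  have loc: "\<exists>n. z \<in> interior (controlled_set u t 0 UNIV n)" if "z \<in> dom (centered_loewner_map u t)" for z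
    using that in_interior_controlled_set[OF u t open_UNIV] by (metis UNIV_I domD)
  have sub: "interior (controlled_set u t 0 UNIV n) \<subseteq> dom (centered_loewner_map u t)" for n
    using controlled_set_subset[OF u t] interior_subset by blast
  have "dom (centered_loewner_map u t) = (\<Union>n. interior (controlled_set u t 0 UNIV n))"
    using loc sub by blast
  then show op: "open (dom (centered_loewner_map u t))" by (metis open_UN open_interior)
  show "continuous_on (dom (centered_loewner_map u t)) (\<lambda>z. the (centered_loewner_map u t z))"
    unfolding continuous_on_eq_continuous_at[OF op]
  proof
    fix z assume "z \<in> dom (centered_loewner_map u t)"
    then obtain n where n: "z \<in> interior (controlled_set u t 0 UNIV n)" using loc by blast
    define d where "d = 1 / real (Suc n)"
    have d: "0 < d" by (simp add: d_def)
    have lip: "(exp (6 / d\<^sup>2 * t))-lipschitz_on UNIV (\<lambda>z. loewner_flow d u z t - u t)"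
      by (rule lipschitz_onI) (use loewner_flow_lipschitz[OF d u t] in \<open>auto simp: dist_norm\<close>)
    have "continuous_on (interior (controlled_set u t 0 UNIV n)) (\<lambda>z. the (centered_loewner_map u t z))"
    proof (rule continuous_on_eq)
      show "continuous_on (interior (controlled_set u t 0 UNIV n)) (\<lambda>z. loewner_flow d u z t - u t)"
        using lipschitz_on_continuous_on[OF lip] continuous_on_subset by blast
      show "loewner_flow d u z t - u t = the (centered_loewner_map u t z)"
        if "z \<in> interior (controlled_set u t 0 UNIV n)" for z
        using that interior_subset[of "controlled_set u t 0 UNIV n"] centered_loewner_map_gap_set[OF d u t, of z]
        by (auto simp: controlled_set_def d_def)
    qed
    then show "isCont (\<lambda>z. the (centered_loewner_map u t z)) z"
      using n continuous_on_eq_continuous_at by blast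
  qed
qed

section \<open>Reversal of time\<close>

text \<open>Reversal changes the velocity to -2 / k, with k the distance vector to the driver, and
  -\<alpha> 2 / k = 2 / (\<alpha> k) as \<alpha>^2 = -1. The rotation is general because
  \<open>i\<close> is used in one direction and \<open>- i\<close> in the other.\<close>

lemma solves_loewner_on_reverse:
  assumes a: "\<alpha>\<^sup>2 = - 1" and g: "solves_loewner_on u t g"
    and v: "\<And>s. s \<in> {0..t} \<Longrightarrow> v s = \<alpha> * u (t - s) + \<beta>"
  shows "solves_loewner_on v t (\<lambda>s. \<alpha> * g (t - s) + \<beta>)"
  unfolding solves_loewner_on_def
proof (intro ballI conjI)
  fix s assume s: "s \<in> {0..t}"
  then have ts: "t - s \<in> {0..t}" by auto
  have a0: "\<alpha> \<noteq> 0" using a by auto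
  have g': "g (t - s) \<noteq> u (t - s)"
    "(g has_vector_derivative 2 / (g (t - s) - u (t - s))) (at (t - s) within {0..t})"
    using g ts unfolding solves_loewner_on_def by blast+
  show "\<alpha> * g (t - s) + \<beta> \<noteq> v s" using g'(1) a0 v[OF s] by simp
  have "((\<lambda>s. t - s) has_vector_derivative - 1) (at s within {0..t})"
    by (auto intro!: derivative_eq_intros)
  moreover have "(\<lambda>s. t - s) ` {0..t} = {0..t}"
    by simp
  ultimately have "((g \<circ> (\<lambda>s. t - s)) has_vector_derivative (- 1) *\<^sub>R (2 / (g (t - s) - u (t - s)))) (at s within {0..t})"
    using g'(2) by (intro vector_diff_chain_within) auto
  then have "((\<lambda>s. \<alpha> * g (t - s) + \<beta>) has_vector_derivative \<alpha> * (- (2 / (g (t - s) - u (t - s))))) (at s within {0..t})"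
    by (auto simp: comp_def intro!: derivative_eq_intros)
  moreover have "\<alpha> * (- (2 / (g (t - s) - u (t - s)))) = 2 / (\<alpha> * g (t - s) + \<beta> - v s)"
  proof -
    define k where "k = g (t - s) - u (t - s)"
    have k: "k \<noteq> 0" using g'(1) by (simp add: k_def)
    have "\<alpha> * g (t - s) + \<beta> - v s = \<alpha> * k" using v[OF s] by (simp add: k_def algebra_simps)
    moreover have "\<alpha> * (- (2 / k)) = - (\<alpha>\<^sup>2) * 2 / (\<alpha> * k)"
      using a0 k by (simp add: power2_eq_square)
    ultimately show ?thesis using a by (simp add: k_def)
  qed
  ultimately show "((\<lambda>s. \<alpha> * g (t - s) + \<beta>) has_vector_derivative 2 / (\<alpha> * g (t - s) + \<beta> - v s)) (at s within {0..t})"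
    by simp
qed

text \<open>\<open>min s t\<close> freezes the path after time \<open>t\<close>: the flow lemmas ask
  for continuity on the whole half-line, and \<open>u\<close> is controlled at nonnegative times
  only.\<close>

definition reversed_driver :: "real \<Rightarrow> (real \<Rightarrow> complex) \<Rightarrow> real \<Rightarrow> complex" where
  "reversed_driver t u s = \<i> * (u (t - min s t) - u t)"

lemma continuous_on_reversed_driver:
  assumes "continuous_on {0..} u"
  shows "continuous_on {0..} (reversed_driver t u)"
  unfolding reversed_driver_def
  by (intro continuous_intros continuous_on_compose2[OF assms]) auto

text \<open>A solution from z to g t becomes one from i (g t - u t) = i w to i (z - u t);
  subtracting the final driver value i (u 0 - u t) leaves i (z - u 0). As an equivalence it settles
  domain, range and injectivity together.\<close>

lemma reversed_driver_map:
  assumes u: "continuous_on {0..} u" and t: "0 \<le> t"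
  shows "centered_loewner_map u t z = Some w \<longleftrightarrow>
    centered_loewner_map (reversed_driver t u) t (\<i> * w) = Some (\<i> * (z - u 0))"
proof -
  let ?W = "reversed_driver t u"
  note W = continuous_on_reversed_driver[OF u, of t]
  show ?thesis
    unfolding centered_loewner_map_eq_Some_iff[OF u t] centered_loewner_map_eq_Some_iff[OF W t]
  proof
    assume "\<exists>g. g 0 = z \<and> solves_loewner_on u t g \<and> w = g t - u t"
    then obtain g where g: "g 0 = z" "solves_loewner_on u t g" "w = g t - u t" by blast
    have "solves_loewner_on ?W t (\<lambda>s. \<i> * g (t - s) + - \<i> * u t)"
      by (rule solves_loewner_on_reverse[OF _ g(2)]) (auto simp: reversed_driver_def algebra_simps min_def)
    then show "\<exists>g. g 0 = \<i> * w \<and> solves_loewner_on ?W t g \<and> \<i> * (z - u 0) = g t - ?W t"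
      using g(1) t unfolding g(3) by (intro exI[of _ "\<lambda>s. \<i> * g (t - s) + - \<i> * u t"])
        (auto simp: algebra_simps reversed_driver_def)
  next
    assume "\<exists>g. g 0 = \<i> * w \<and> solves_loewner_on ?W t g \<and> \<i> * (z - u 0) = g t - ?W t"
    then obtain g where g: "g 0 = \<i> * w" "solves_loewner_on ?W t g" "\<i> * (z - u 0) = g t - ?W t" by blast
    have "solves_loewner_on u t (\<lambda>s. - \<i> * g (t - s) + u t)"
      by (rule solves_loewner_on_reverse[OF _ g(2)]) (auto simp: reversed_driver_def algebra_simps min_def)
    moreover have "- \<i> * g t + u t = z"
    proof -
      have "g t = \<i> * (z - u t)" using g(3) t by (simp add: reversed_driver_def algebra_simps)
      then show ?thesis by simp
    qed
    ultimately show "\<exists>g. g 0 = z \<and> solves_loewner_on u t g \<and> w = g t - u t"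
      using g t by (intro exI[of _ "\<lambda>s. - \<i> * g (t - s) + u t"]) auto
  qed
qed

section \<open>Measurability in the driving function\<close>

text \<open>The complement is the union of the open balls around the points outside
  \<open>V\<close>. This is why a margin around the image turns an open condition into a closed
  one.\<close>

lemma closed_ball_subset: "closed {x :: 'a::metric_space. ball x d \<subseteq> V}"
proof -
  have "{x. ball x d \<subseteq> V} = - (\<Union>y\<in>- V. ball y d)"
    by (auto simp: dist_commute)
  then show ?thesis by (metis closed_Compl open_UN open_ball)
qed

text \<open>The distance to the driver is continuous in time, so a closed bound on a dense set of
  times extends to all of them.\<close>

lemma gap_set_dense_iff:
  assumes d: "0 < d" and u: "continuous_on {0..} u"
    and Q: "Q \<subseteq> {0..t}" "{0..t} \<subseteq> closure Q"
  shows "z \<in> gap_set d u t \<longleftrightarrow> (\<forall>s\<in>Q. d \<le> cmod (loewner_flow d u z s - u s))"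
proof
  assume *: "\<forall>s\<in>Q. d \<le> cmod (loewner_flow d u z s - u s)"
  have "continuous_on {0..t} (\<lambda>s. cmod (loewner_flow d u z s - u s))"
    by (intro continuous_intros)
       (auto intro: continuous_on_subset[OF continuous_on_loewner_flow[OF d u]] continuous_on_subset[OF u])
  from continuous_closed_preimage[OF this, of "{d..}"]
  have "closed ({0..t} \<inter> (\<lambda>s. cmod (loewner_flow d u z s - u s)) -` {d..})" by simp
  then have "closure Q \<subseteq> {0..t} \<inter> (\<lambda>s. cmod (loewner_flow d u z s - u s)) -` {d..}"
    using * Q(1) by (intro closure_minimal) auto
  then show "z \<in> gap_set d u t" using Q(2) unfolding gap_set_def by force
qed (use Q in \<open>auto simp: gap_set_def\<close>)

text \<open>Allows the inclusion of a set \<open>K\<close> to be tested on a countable dense subset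
  of \<open>K\<close>.\<close>

lemma closed_controlled_set:
  assumes u: "continuous_on {0..} u" and t: "0 \<le> t"
  shows "closed (controlled_set u t v V n)"
proof -
  define d where "d = 1 / real (Suc n)"
  have d: "0 < d" by (simp add: d_def)
  have cont: "continuous_on UNIV (\<lambda>z. loewner_flow d u z s)" if "0 \<le> s" for s
  proof -
    have "(exp (6 / d\<^sup>2 * s))-lipschitz_on UNIV (\<lambda>z. loewner_flow d u z s)"
      by (rule lipschitz_onI) (use loewner_flow_lipschitz[OF d u that] in \<open>auto simp: dist_norm\<close>)
    then show ?thesis by (rule lipschitz_on_continuous_on)
  qed
  have "controlled_set u t v V n = (\<Inter>s\<in>{0..t}. {z. d \<le> cmod (loewner_flow d u z s - u s)})
      \<inter> (\<lambda>z. loewner_flow d u z t - u t + v) -` {x. ball x d \<subseteq> V}"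
    unfolding controlled_set_def gap_set_def d_def[symmetric] by auto
  moreover have "closed {z. d \<le> cmod (loewner_flow d u z s - u s)}" if "s \<in> {0..t}" for s
    using that by (intro closed_Collect_le continuous_intros cont) auto
  moreover have "closed ((\<lambda>z. loewner_flow d u z t - u t + v) -` {x. ball x d \<subseteq> V})"
    by (intro continuous_closed_vimage closed_ball_subset)
       (use cont[OF t] in \<open>auto simp: continuous_on_eq_continuous_at intro!: continuous_intros\<close>)
  ultimately show ?thesis by (simp only:) (intro closed_Int closed_INT ballI)
qed

text \<open>Measurability is asked for up to time \<open>t\<close> only, since the locale is also
  instantiated with the canonical path space, whose events see no later time.\<close>

locale continuous_driver =
  fixes M :: "'w measure" and U :: "real \<Rightarrow> 'w \<Rightarrow> complex" and t :: real
  assumes time_nonneg: "0 \<le> t"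
    and measurable_driver: "\<And>s. 0 \<le> s \<Longrightarrow> s \<le> t \<Longrightarrow> U s \<in> borel_measurable M"
    and continuous_path: "\<And>\<omega>. \<omega> \<in> space M \<Longrightarrow> continuous_on {0..} (\<lambda>s. U s \<omega>)"
begin

lemma measurable_flow:
  assumes d: "0 < d" and s: "0 \<le> s" "s \<le> t"
  shows "(\<lambda>\<omega>. loewner_flow d (\<lambda>r. U r \<omega>) z s) \<in> borel_measurable M"
proof (rule borel_measurable_LIMSEQ_metric)
  fix n
  define h where "h = s / real (Suc n)"
  have h: "0 \<le> h" "real (Suc n) * h = s" using s by (auto simp: h_def)
  have tf[measurable]: "truncated_field d \<in> borel_measurable borel"
    by (intro borel_measurable_continuous_onI continuous_on_truncated_field[OF d] continuous_on_id)
  have "(\<lambda>\<omega>. euler (\<lambda>r x. truncated_field d (x - U r \<omega>)) z h k) \<in> borel_measurable M" if "k \<le> Suc n" for k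
    using that
  proof (induction k)
    case 0
    then show ?case by simp
  next
    case (Suc k)
    \<comment> \<open>Every node of the scheme lies in \<open>{0..s}\<close>, so only the driver up
      to time \<open>t\<close> enters.\<close>
    have "real k * h \<le> real (Suc n) * h" using Suc h by (intro mult_right_mono) auto
    then have [measurable]: "U (real k * h) \<in> borel_measurable M"
      using h s by (intro measurable_driver) auto
    have [measurable]: "(\<lambda>\<omega>. euler (\<lambda>r x. truncated_field d (x - U r \<omega>)) z h k) \<in> borel_measurable M"
      using Suc by simp
    show ?case by simp
  qed
  then show "(\<lambda>\<omega>. euler (\<lambda>r x. truncated_field d (x - U r \<omega>)) z (s / real (Suc n)) (Suc n))
      \<in> borel_measurable M"
    by (simp only: h_def)
next
  fix \<omega> assume "\<omega> \<in> space M"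
  then show "(\<lambda>n. euler (\<lambda>r x. truncated_field d (x - U r \<omega>)) z (s / real (Suc n)) (Suc n))
      \<longlonglongrightarrow> loewner_flow d (\<lambda>r. U r \<omega>) z s"
    by (intro loewner_flow_euler d continuous_path s)
qed

text \<open>Countable dense sets \<open>D\<close> of points and \<open>Q\<close> of times reduce the
  event to countably many conditions on the flow at a fixed point and time.\<close>

lemma sets_controlled_set:
  assumes v[measurable]: "v \<in> borel_measurable M"
  shows "{\<omega> \<in> space M. K \<subseteq> controlled_set (\<lambda>s. U s \<omega>) t (v \<omega>) V n} \<in> sets M"
proof -
  define d where "d = 1 / real (Suc n)"
  have d: "0 < d" by (simp add: d_def)
  obtain D where D: "countable D" "D \<subseteq> K" "K \<subseteq> closure D" by (rule separable)
  obtain Q where Q: "countable Q" "Q \<subseteq> {0..t}" "{0..t} \<subseteq> closure Q" by (rule separable)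
  have B[measurable]: "{x :: complex. ball x d \<subseteq> V} \<in> sets borel"
    by (intro borel_closed closed_ball_subset)
  have "{\<omega> \<in> space M. K \<subseteq> controlled_set (\<lambda>s. U s \<omega>) t (v \<omega>) V n}
      = {\<omega> \<in> space M. \<forall>z\<in>D. (\<forall>s\<in>Q. d \<le> cmod (loewner_flow d (\<lambda>r. U r \<omega>) z s - U s \<omega>)) \<and>
          loewner_flow d (\<lambda>r. U r \<omega>) z t - U t \<omega> + v \<omega> \<in> {x. ball x d \<subseteq> V}}"
  proof (rule Collect_cong, rule conj_cong[OF refl])
    fix \<omega> assume \<omega>: "\<omega> \<in> space M"
    note u = continuous_path[OF \<omega>]
    have "K \<subseteq> controlled_set (\<lambda>s. U s \<omega>) t (v \<omega>) V n \<longleftrightarrow> D \<subseteq> controlled_set (\<lambda>s. U s \<omega>) t (v \<omega>) V n"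
      using closure_minimal[OF _ closed_controlled_set[OF u time_nonneg]] D(2,3) by blast
    then show "K \<subseteq> controlled_set (\<lambda>s. U s \<omega>) t (v \<omega>) V n \<longleftrightarrow>
      (\<forall>z\<in>D. (\<forall>s\<in>Q. d \<le> cmod (loewner_flow d (\<lambda>r. U r \<omega>) z s - U s \<omega>)) \<and>
          loewner_flow d (\<lambda>r. U r \<omega>) z t - U t \<omega> + v \<omega> \<in> {x. ball x d \<subseteq> V})"
      unfolding controlled_set_def d_def[symmetric] using gap_set_dense_iff[OF d u Q(2,3)] by auto
  qed
  also have "\<dots> \<in> sets M"
  proof (intro sets.sets_Collect_countable_All' D(1) Q(1) sets.sets_Collect_conj)
    fix z s assume s: "s \<in> Q"
    have [measurable]: "(\<lambda>\<omega>. loewner_flow d (\<lambda>r. U r \<omega>) z s) \<in> borel_measurable M" "U s \<in> borel_measurable M"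
      using s Q(2) by (auto intro!: measurable_flow measurable_driver d)
    show "{\<omega> \<in> space M. d \<le> cmod (loewner_flow d (\<lambda>r. U r \<omega>) z s - U s \<omega>)} \<in> sets M" by measurable
  next
    fix z
    have [measurable]: "(\<lambda>\<omega>. loewner_flow d (\<lambda>r. U r \<omega>) z t) \<in> borel_measurable M" "U t \<in> borel_measurable M"
      using time_nonneg by (auto intro!: measurable_flow measurable_driver d)
    show "{\<omega> \<in> space M. loewner_flow d (\<lambda>r. U r \<omega>) z t - U t \<omega> + v \<omega> \<in> {x. ball x d \<subseteq> V}} \<in> sets M"
      by measurable
  qed
  finally show ?thesis .
qed

text \<open>These events generate the law of the map; with \<open>V = UNIV\<close> and shift 0 they
  also give the generating events for the left hull.\<close>

lemma sets_compact_into_open: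
  assumes v: "v \<in> borel_measurable M" and K: "compact K" and V: "open V"
  shows "{\<omega> \<in> space M. \<forall>z\<in>K. \<exists>w. centered_loewner_map (\<lambda>s. U s \<omega>) t z = Some w \<and> w + v \<omega> \<in> V} \<in> sets M"
proof -
  have "(\<forall>z\<in>K. \<exists>w. centered_loewner_map (\<lambda>s. U s \<omega>) t z = Some w \<and> w + v \<omega> \<in> V)
      \<longleftrightarrow> (\<exists>n. K \<subseteq> controlled_set (\<lambda>s. U s \<omega>) t (v \<omega>) V n)" if "\<omega> \<in> space M" for \<omega>
    by (rule compact_subset_controlled_iff[OF continuous_path[OF that] time_nonneg V K])
  then have "{\<omega> \<in> space M. \<forall>z\<in>K. \<exists>w. centered_loewner_map (\<lambda>s. U s \<omega>) t z = Some w \<and> w + v \<omega> \<in> V}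
      = {\<omega> \<in> space M. \<exists>n. K \<subseteq> controlled_set (\<lambda>s. U s \<omega>) t (v \<omega>) V n}"
    by (intro Collect_cong conj_cong refl)
  also have "\<dots> \<in> sets M" by (intro sets.sets_Collect_countable_Ex sets_controlled_set v)
  finally show ?thesis .
qed

text \<open>The shift is there for the inverse map, which differs from the map of the reversed
  driver by \<open>i U 0\<close>. That term vanishes only almost surely, and almost sure equality
  does not transfer measurability in an incomplete space.\<close>

lemma measurable_shifted_centered_loewner_map:
  assumes v: "v \<in> borel_measurable M"
  shows "(\<lambda>\<omega> z. map_option (\<lambda>w. w + v \<omega>) (centered_loewner_map (\<lambda>s. U s \<omega>) t z))
    \<in> measurable M partial_map_space"
  unfolding partial_map_space_def Let_def
proof (rule measurable_measure_of)
  let ?\<Omega> = "{f :: complex \<rightharpoonup> complex. open (dom f) \<and> continuous_on (dom f) (\<lambda>z. the (f z))}"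
  let ?X = "\<lambda>\<omega> z. map_option (\<lambda>w. w + v \<omega>) (centered_loewner_map (\<lambda>s. U s \<omega>) t z)"
  show X: "?X \<in> space M \<rightarrow> ?\<Omega>"
  proof
    fix \<omega> assume \<omega>: "\<omega> \<in> space M"
    let ?c = "centered_loewner_map (\<lambda>s. U s \<omega>) t"
    have dom: "dom (?X \<omega>) = dom ?c" by (auto simp: dom_def)
    have "continuous_on (dom ?c) (\<lambda>z. the (?c z) + v \<omega>)"
      by (intro continuous_intros continuous_on_centered_loewner_map continuous_path \<omega> time_nonneg)
    moreover have "the (?c z) + v \<omega> = the (?X \<omega> z)" if "z \<in> dom ?c" for z
      using that by auto
    ultimately have "continuous_on (dom ?c) (\<lambda>z. the (?X \<omega> z))" by (rule continuous_on_eq)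
    then show "?X \<omega> \<in> ?\<Omega>"
      using open_dom_centered_loewner_map[OF continuous_path[OF \<omega>] time_nonneg] unfolding mem_Collect_eq dom by blast
  qed
  fix A assume "A \<in> {{f \<in> ?\<Omega>. K \<subseteq> dom f \<and> (\<lambda>z. the (f z)) ` K \<subseteq> V} |K V. compact K \<and> open V}"
  then obtain K V where A: "A = {f \<in> ?\<Omega>. K \<subseteq> dom f \<and> (\<lambda>z. the (f z)) ` K \<subseteq> V}"
    and K: "compact K" and V: "open V" by blast
  have "K \<subseteq> dom (?X \<omega>) \<and> (\<lambda>z. the (?X \<omega> z)) ` K \<subseteq> V \<longleftrightarrow>
      (\<forall>z\<in>K. \<exists>w. centered_loewner_map (\<lambda>s. U s \<omega>) t z = Some w \<and> w + v \<omega> \<in> V)" for \<omega>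
    by (force simp: dom_def subset_iff image_iff)
  then have "?X -` A \<inter> space M =
      {\<omega> \<in> space M. \<forall>z\<in>K. \<exists>w. centered_loewner_map (\<lambda>s. U s \<omega>) t z = Some w \<and> w + v \<omega> \<in> V}"
    using X unfolding A by blast
  then show "?X -` A \<inter> space M \<in> sets M" using sets_compact_into_open[OF v K V] by simp
qed auto

lemma measurable_centered_loewner_map:
  "(\<lambda>\<omega>. centered_loewner_map (\<lambda>s. U s \<omega>) t) \<in> measurable M partial_map_space"
  using measurable_shifted_centered_loewner_map[of "\<lambda>_. 0"] by (simp add: option.map_ident)

text \<open>The left hull misses \<open>K\<close> exactly when \<open>K\<close> lies in the domain
  of the map, that is, when \<open>K\<close> is mapped into \<open>UNIV\<close>.\<close>

lemma measurable_left_hull: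
  "(\<lambda>\<omega>. left_hull (\<lambda>s. U s \<omega>) t) \<in> measurable M closed_set_space"
  unfolding closed_set_space_def
proof (rule measurable_measure_of)
  have compl: "left_hull u t = - dom (centered_loewner_map u t)" for u
    by (simp add: dom_centered_loewner_map)
  show X: "(\<lambda>\<omega>. left_hull (\<lambda>s. U s \<omega>) t) \<in> space M \<rightarrow> {F. closed F}"
    using open_dom_centered_loewner_map[OF continuous_path time_nonneg] by (auto simp: compl)
  fix A :: "complex set set" assume "A \<in> {{F. closed F \<and> F \<inter> K = {}} |K. compact K}"
  then obtain K where A: "A = {F. closed F \<and> F \<inter> K = {}}" and K: "compact K" by blast
  have "(\<lambda>\<omega>. left_hull (\<lambda>s. U s \<omega>) t) -` A \<inter> space M =
      {\<omega> \<in> space M. \<forall>z\<in>K. \<exists>w. centered_loewner_map (\<lambda>s. U s \<omega>) t z = Some w \<and> w + 0 \<in> UNIV}"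
    using X unfolding A compl by (auto simp: dom_def)
  then show "(\<lambda>\<omega>. left_hull (\<lambda>s. U s \<omega>) t) -` A \<inter> space M \<in> sets M"
    using sets_compact_into_open[of "\<lambda>_. 0" K UNIV] K by simp
qed auto

lemma continuous_driver_reversed:
  "continuous_driver M (\<lambda>s \<omega>. reversed_driver t (\<lambda>r. U r \<omega>) s) t"
proof
  fix s assume s: "0 \<le> s" "s \<le> t"
  then have [measurable]: "U (t - min s t) \<in> borel_measurable M" "U t \<in> borel_measurable M"
    using time_nonneg by (auto intro!: measurable_driver)
  show "(\<lambda>\<omega>. reversed_driver t (\<lambda>r. U r \<omega>) s) \<in> borel_measurable M"
    unfolding reversed_driver_def by measurable
qed (auto intro: time_nonneg continuous_on_reversed_driver continuous_path)

end

text \<open>Multiplication by \<open>c\<close> is a homeomorphism of the plane, and the image of a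
  closed set misses \<open>K\<close> exactly when the set misses the compact set \<open>K\<close>
  divided by \<open>c\<close>.\<close>

lemma measurable_closed_set_image:
  fixes c :: complex
  assumes "c \<noteq> 0"
  shows "(`) ((*) c) \<in> measurable closed_set_space closed_set_space"
proof -
  have inj: "inj ((*) c)" using assms by (auto intro: injI)
  have closed: "closed ((*) c ` F)" if "closed F" for F
    by (rule closed_injective_linear_image[OF that _ inj]) (simp add: bounded_linear.linear bounded_linear_mult_right)
  show ?thesis
    unfolding closed_set_space_def
  proof (rule measurable_measure_of)
    show "(`) ((*) c) \<in> space (sigma {F. closed F} {{F. closed F \<and> F \<inter> K = {}} |K. compact K}) \<rightarrow> {F. closed F}"
      using closed by (subst space_measure_of) auto
    fix A :: "complex set set" assume "A \<in> {{F. closed F \<and> F \<inter> K = {}} |K. compact K}"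
    then obtain K where A: "A = {F. closed F \<and> F \<inter> K = {}}" and K: "compact K" by blast
    have "c * z \<in> K \<longleftrightarrow> z \<in> (*) (inverse c) ` K" for z
      using assms by (auto simp: image_iff field_simps intro!: bexI[of _ "c * z"])
    then have "(`) ((*) c) -` A \<inter> {F. closed F} = {F. closed F \<and> F \<inter> (*) (inverse c) ` K = {}}"
      using closed unfolding A by blast
    moreover have "compact ((*) (inverse c) ` K)"
      by (intro compact_continuous_image K continuous_intros)
    ultimately show "(`) ((*) c) -` A \<inter> space (sigma {F. closed F} {{F. closed F \<and> F \<inter> K = {}} |K. compact K})
        \<in> sets (sigma {F. closed F} {{F. closed F \<and> F \<inter> K = {}} |K. compact K})"
      by (subst space_measure_of, force, subst sets_measure_of, force) (auto intro!: sigma_sets.Basic)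
  qed auto
qed

section \<open>Hulls and inverse map under reversal\<close>

text \<open>By \<open>reversed_driver_map\<close>, \<open>w\<close> is a final value of the chain
  exactly when \<open>i w\<close> is an admissible starting point of the reversed one; then take
  complements.\<close>

lemma right_hull_reversed_driver:
  assumes u: "continuous_on {0..} u" and t: "0 \<le> t"
  shows "(*) \<i> ` right_hull u t = left_hull (reversed_driver t u) t"
proof -
  have "w \<in> ran (centered_loewner_map u t) \<longleftrightarrow> \<i> * w \<in> dom (centered_loewner_map (reversed_driver t u) t)" for w
  proof
    assume "\<i> * w \<in> dom (centered_loewner_map (reversed_driver t u) t)"
    then obtain y where "centered_loewner_map (reversed_driver t u) t (\<i> * w) = Some y" by blast
    then have "centered_loewner_map u t (- \<i> * y + u 0) = Some w"
      unfolding reversed_driver_map[OF u t] by simp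
    then show "w \<in> ran (centered_loewner_map u t)" by (rule ranI)
  qed (use reversed_driver_map[OF u t] in \<open>auto simp: ran_def\<close>)
  then have "w \<in> right_hull u t \<longleftrightarrow> \<i> * w \<in> left_hull (reversed_driver t u) t" for w
    using dom_centered_loewner_map[of "reversed_driver t u" t] by (auto simp: right_hull_def)
  moreover have "w = \<i> * (- \<i> * w)" for w by simp
  ultimately show ?thesis by (metis (no_types, lifting) image_eqI image_subsetI subsetI subset_antisym)
qed

text \<open>A starting point \<open>z\<close> corresponds to the final value i (z - u 0) of the
  reversed chain. The assumption on \<open>u 0\<close> removes this translation, so for Brownian
  motion the equality is an almost sure one.\<close>

lemma left_hull_reversed_driver:
  assumes u: "continuous_on {0..} u" and t: "0 \<le> t" and u0: "u 0 = 0"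
  shows "(*) \<i> ` left_hull u t = right_hull (reversed_driver t u) t"
proof -
  have "z \<in> dom (centered_loewner_map u t) \<longleftrightarrow> \<i> * z \<in> ran (centered_loewner_map (reversed_driver t u) t)" for z
  proof
    assume "\<i> * z \<in> ran (centered_loewner_map (reversed_driver t u) t)"
    then obtain y where "centered_loewner_map (reversed_driver t u) t y = Some (\<i> * z)"
      by (auto simp: ran_def)
    then have "centered_loewner_map u t z = Some (- \<i> * y)"
      unfolding reversed_driver_map[OF u t] u0 by simp
    then show "z \<in> dom (centered_loewner_map u t)" by (rule domI)
  qed (use reversed_driver_map[OF u t] u0 in \<open>auto intro: ranI\<close>)
  then have "z \<in> left_hull u t \<longleftrightarrow> \<i> * z \<in> right_hull (reversed_driver t u) t" for z
    using dom_centered_loewner_map[of u t] by (auto simp: right_hull_def)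
  moreover have "w = \<i> * (- \<i> * w)" for w by simp
  ultimately show ?thesis by (metis (no_types, lifting) image_eqI image_subsetI subsetI subset_antisym)
qed

lemma map_inverse_reversed_driver:
  assumes u: "continuous_on {0..} u" and t: "0 \<le> t"
  shows "map_option (\<lambda>w. \<i> * w) (map_inverse (centered_loewner_map u t) (- \<i> * z))
    = map_option (\<lambda>w. w + \<i> * u 0) (centered_loewner_map (reversed_driver t u) t z)"
proof (cases "centered_loewner_map (reversed_driver t u) t z")
  case None
  have "- \<i> * z \<notin> ran (centered_loewner_map u t)"
    using None reversed_driver_map[OF u t, of _ "- \<i> * z"] by (auto simp: ran_def)
  then show ?thesis using None by (simp add: map_inverse_def)
next
  case (Some y)
  define x where "x = - \<i> * y + u 0"
  \<comment> \<open>The preimage is unique, which gives the description in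
    \<open>map_inverse\<close> its value.\<close>
  have x: "centered_loewner_map u t x' = Some (- \<i> * z) \<longleftrightarrow> x' = x" for x'
    unfolding reversed_driver_map[OF u t] using Some by (auto simp: x_def complex_eq_iff)
  then have "- \<i> * z \<in> ran (centered_loewner_map u t)" by (auto simp: ran_def)
  moreover have "(THE x'. centered_loewner_map u t x' = Some (- \<i> * z)) = x"
    unfolding x by simp
  ultimately have "map_inverse (centered_loewner_map u t) (- \<i> * z) = Some x"
    by (simp add: map_inverse_def)
  then show ?thesis using Some by (simp add: x_def algebra_simps)
qed

context continuous_driver
begin

text \<open>The complement of a range is not accessible through events about the domain, but a
  rotation turns it into the left hull of the reversed driver.\<close>

lemma measurable_right_hull:
  "(\<lambda>\<omega>. right_hull (\<lambda>s. U s \<omega>) t) \<in> measurable M closed_set_space"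
proof -
  interpret rev: continuous_driver M "\<lambda>s \<omega>. reversed_driver t (\<lambda>r. U r \<omega>) s" t
    by (rule continuous_driver_reversed)
  have "(\<lambda>\<omega>. (*) (- \<i>) ` left_hull (reversed_driver t (\<lambda>r. U r \<omega>)) t) \<in> measurable M closed_set_space"
    by (rule measurable_compose[OF rev.measurable_left_hull measurable_closed_set_image]) simp
  moreover have "(*) (- \<i>) ` left_hull (reversed_driver t (\<lambda>r. U r \<omega>)) t = right_hull (\<lambda>s. U s \<omega>) t"
    if "\<omega> \<in> space M" for \<omega>
    by (simp add: image_image flip: right_hull_reversed_driver[OF continuous_path[OF that] time_nonneg])
  ultimately show ?thesis by (simp cong: measurable_cong)
qed

end

section \<open>Laws of processes with independent increments\<close>

text \<open>Dividing the weights by their common mass gives probability densities, and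
  \<open>Levy_uniqueness\<close> applies to the laws of \<open>Y\<close> and \<open>Z\<close> under
  them.\<close>

lemma weighted_char_unique:
  fixes f :: "'a \<Rightarrow> real" and g :: "'b \<Rightarrow> real"
  assumes M: "prob_space M" and N: "prob_space N"
    and f: "integrable M f" "\<And>x. 0 \<le> f x" and g: "integrable N g" "\<And>x. 0 \<le> g x"
    and Y[measurable]: "Y \<in> borel_measurable M" and Z[measurable]: "Z \<in> borel_measurable N"
    and eq: "\<And>t. (CLINT x|M. complex_of_real (f x) * iexp (t * Y x)) = (CLINT x|N. complex_of_real (g x) * iexp (t * Z x))"
    and B[measurable]: "B \<in> sets borel"
  shows "(LINT x|M. f x * indicator B (Y x)) = (LINT x|N. g x * indicator B (Z x))"
proof -
  have [measurable]: "f \<in> borel_measurable M" "g \<in> borel_measurable N" using f g by auto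
  define c where "c = (LINT x|M. f x)"
  \<comment> \<open>The characteristic identity at frequency 0 says that the two masses
    agree.\<close>
  have cN: "(LINT x|N. g x) = c"
    using eq[of 0] by (simp add: c_def)
  have fi: "integrable M (\<lambda>x. f x * indicator B (Y x))"
    by (rule Bochner_Integration.integrable_bound[OF f(1)]) (auto simp: indicator_def)
  have gi: "integrable N (\<lambda>x. g x * indicator B (Z x))"
    by (rule Bochner_Integration.integrable_bound[OF g(1)]) (auto simp: indicator_def)
  have c0: "0 \<le> c" unfolding c_def using f by (intro Bochner_Integration.integral_nonneg) auto
  show ?thesis
  proof (cases "c = 0")
    \<comment> \<open>Zero mass cannot be normalised, but both sides then lie between 0 and
      \<open>c\<close>.\<close>
    case True
    have "(LINT x|M. f x * indicator B (Y x)) \<le> c"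
      unfolding c_def by (intro integral_mono fi f) (use f in \<open>auto simp: indicator_def\<close>)
    moreover have "0 \<le> (LINT x|M. f x * indicator B (Y x))"
      using f by (intro Bochner_Integration.integral_nonneg) auto
    moreover have "(LINT x|N. g x * indicator B (Z x)) \<le> c"
      unfolding cN[symmetric] by (intro integral_mono gi g) (use g in \<open>auto simp: indicator_def\<close>)
    moreover have "0 \<le> (LINT x|N. g x * indicator B (Z x))"
      using g by (intro Bochner_Integration.integral_nonneg) auto
    ultimately show ?thesis using True by linarith
  next
    case False
    with c0 have c: "0 < c" by simp
    have *: "real_distribution (distr (density K (\<lambda>x. ennreal (h x / c))) borel W)"
        "char (distr (density K (\<lambda>x. ennreal (h x / c))) borel W) t
          = (CLINT x|K. complex_of_real (h x) * iexp (t * W x)) / c"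
        "measure (distr (density K (\<lambda>x. ennreal (h x / c))) borel W) B
          = (LINT x|K. h x * indicator B (W x)) / c"
      if h: "integrable K h" "\<And>x. 0 \<le> h x" "(LINT x|K. h x) = c" and W: "W \<in> borel_measurable K"
      for K and h :: "'c \<Rightarrow> real" and W t
    proof -
      have [measurable]: "h \<in> borel_measurable K" "W \<in> borel_measurable K" using h W by auto
      have "prob_space (density K (\<lambda>x. ennreal (h x / c)))"
      proof
        have "emeasure (density K (\<lambda>x. ennreal (h x / c))) (space (density K (\<lambda>x. ennreal (h x / c))))
            = (\<integral>\<^sup>+ x. ennreal (h x / c) \<partial>K)"
          by (simp add: emeasure_density cong: nn_integral_cong)
        also have "\<dots> = ennreal (LINT x|K. h x / c)"
          by (rule nn_integral_eq_integral) (use h c in auto)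
        finally show "emeasure (density K (\<lambda>x. ennreal (h x / c))) (space (density K (\<lambda>x. ennreal (h x / c)))) = 1"
          using h c by simp
      qed
      then show "real_distribution (distr (density K (\<lambda>x. ennreal (h x / c))) borel W)"
        by (intro prob_space.real_distribution_distr) auto
      show "char (distr (density K (\<lambda>x. ennreal (h x / c))) borel W) t
          = (CLINT x|K. complex_of_real (h x) * iexp (t * W x)) / c"
        unfolding char_def using h c
        by (subst integral_distr, simp, simp, subst integral_density)
           (auto simp: scaleR_conv_of_real simp flip: integral_divide_zero intro!: Bochner_Integration.integral_cong)
      have "measure (distr (density K (\<lambda>x. ennreal (h x / c))) borel W) B
          = (LINT x|distr (density K (\<lambda>x. ennreal (h x / c))) borel W. indicator B x)"
        by simp
      also have "\<dots> = (LINT x|K. h x * indicator B (W x)) / c"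
        using h c by (subst integral_distr, simp, simp, subst integral_density)
           (auto simp flip: integral_divide_zero intro!: Bochner_Integration.integral_cong)
      finally show "measure (distr (density K (\<lambda>x. ennreal (h x / c))) borel W) B
          = (LINT x|K. h x * indicator B (W x)) / c" .
    qed
    have "distr (density M (\<lambda>x. ennreal (f x / c))) borel Y = distr (density N (\<lambda>x. ennreal (g x / c))) borel Z"
      by (rule Levy_uniqueness)
         (use *[OF f c_def[symmetric] Y] *[OF g cN Z] eq in auto)
    then show ?thesis using *(3)[OF f c_def[symmetric] Y] *(3)[OF g cN Z] c by simp
  qed
qed

text \<open>
  The two-dimensional uniqueness is reduced to the theorem of Levy on the line, used twice: first for
  the imaginary part with the weights \<open>1 + cos (s * Re X + r)\<close>, then for the real part with the
  indicator of an event of the imaginary part as weight.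
\<close>

lemma cramer_wold_complex:
  assumes M: "prob_space M" and N: "prob_space N"
    and X[measurable]: "X \<in> borel_measurable M" and Y[measurable]: "Y \<in> borel_measurable N"
    and eq: "\<And>a b. distr M borel (\<lambda>\<omega>. a * Re (X \<omega>) + b * Im (X \<omega>))
                = distr N borel (\<lambda>\<omega>. a * Re (Y \<omega>) + b * Im (Y \<omega>))"
  shows "distr M borel X = distr N borel Y"
proof -
  interpret M: prob_space M by fact
  interpret N: prob_space N by fact
  have int: "integrable K (\<lambda>x. iexp (h x))" if "prob_space K" "h \<in> borel_measurable K" for K and h :: "'c \<Rightarrow> real"
  proof -
    interpret prob_space K by fact
    show ?thesis by (rule integrable_const_bound[of _ 1]) (use that in auto)
  qed
  have \<phi>: "(CLINT x|M. iexp (a * Re (X x) + b * Im (X x))) = (CLINT x|N. iexp (a * Re (Y x) + b * Im (Y x)))" for a b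
  proof -
    have "(CLINT x|M. iexp (a * Re (X x) + b * Im (X x)))
        = (CLINT y|distr M borel (\<lambda>\<omega>. a * Re (X \<omega>) + b * Im (X \<omega>)). iexp y)"
      by (subst integral_distr) auto
    also have "\<dots> = (CLINT x|N. iexp (a * Re (Y x) + b * Im (Y x)))"
      unfolding eq by (subst integral_distr) auto
    finally show ?thesis .
  qed
  have cos_bound: "norm (1 + cos r) \<le> 2" for r :: real
    unfolding real_norm_def abs_le_iff using cos_le_one[of r] cos_ge_minus_one[of r] by linarith
  \<comment> \<open>The summand 1 makes the weight nonnegative, as a density must be; the phase
    \<open>r\<close> provides both the cosine and the sine below.\<close>
  have cos_Im: "(LINT x|M. (1 + cos (s * Re (X x) + r)) * indicator B (Im (X x)))
      = (LINT x|N. (1 + cos (s * Re (Y x) + r)) * indicator B (Im (Y x)))"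
    if B: "B \<in> sets borel" for s r B
  proof (rule weighted_char_unique[OF M N])
    \<comment> \<open>Euler's formula for the cosine expresses the weighted transform by three
      values of the two-variable characteristic function, which \<open>\<phi>\<close>
      compares.\<close>
    have split: "(CLINT x|K. complex_of_real (1 + cos (s * Re (W x) + r)) * iexp (t * Im (W x)))
       = (CLINT x|K. iexp (0 * Re (W x) + t * Im (W x)))
         + (iexp r / 2 * (CLINT x|K. iexp (s * Re (W x) + t * Im (W x)))
         + iexp (- r) / 2 * (CLINT x|K. iexp (- s * Re (W x) + t * Im (W x))))"
      if K: "prob_space K" and W[measurable]: "W \<in> borel_measurable K" for K and W :: "'c \<Rightarrow> complex" and t
    proof -
      have "complex_of_real (1 + cos (s * Re (W x) + r)) * iexp (t * Im (W x))
        = iexp (0 * Re (W x) + t * Im (W x)) + (iexp r / 2 * iexp (s * Re (W x) + t * Im (W x))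
          + iexp (- r) / 2 * iexp (- s * Re (W x) + t * Im (W x)))" for x
        by (simp add: cos_of_real[symmetric] cos_exp_eq algebra_simps add_divide_distrib del: cos_of_real flip: exp_add)
      moreover have "integrable K (\<lambda>x. iexp (a * Re (W x) + b * Im (W x)))" for a b
        by (rule int[OF K]) auto
      ultimately show ?thesis
        by (simp only: Bochner_Integration.integral_add Bochner_Integration.integrable_add
            integrable_mult_right integral_mult_right_zero)
    qed
    show "(CLINT x|M. complex_of_real (1 + cos (s * Re (X x) + r)) * iexp (t * Im (X x)))
       = (CLINT x|N. complex_of_real (1 + cos (s * Re (Y x) + r)) * iexp (t * Im (Y x)))" for t
      unfolding split[OF M X] split[OF N Y] \<phi> ..
    show "integrable M (\<lambda>x. 1 + cos (s * Re (X x) + r))"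
      by (rule M.integrable_const_bound[OF AE_I2[OF cos_bound]]) measurable
    show "integrable N (\<lambda>x. 1 + cos (s * Re (Y x) + r))"
      by (rule N.integrable_const_bound[OF AE_I2[OF cos_bound]]) measurable
    show "0 \<le> 1 + cos (s * Re (X x) + r)" for x using cos_ge_minus_one[of "s * Re (X x) + r"] by linarith
    show "0 \<le> 1 + cos (s * Re (Y x) + r)" for x using cos_ge_minus_one[of "s * Re (Y x) + r"] by linarith
  qed (use B in auto)
  have ind: "(LINT x|M. indicator B (Im (X x)) * indicator A (Re (X x)) :: real)
      = (LINT x|N. indicator B (Im (Y x)) * indicator A (Re (Y x)))"
    if [measurable]: "A \<in> sets borel" "B \<in> sets borel" for A B
  proof (rule weighted_char_unique[OF M N])
    \<comment> \<open>The subtracted integrals have weight 1 + cos (pi / 2) = 1, put in the form of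
      \<open>cos_Im\<close>, and the phase - pi / 2 turns the cosine into the sine.\<close>
    have split: "(CLINT x|K. complex_of_real (indicator B (Im (W x))) * iexp (s * Re (W x)))
        = complex_of_real ((LINT x|K. (1 + cos (s * Re (W x) + 0)) * indicator B (Im (W x))) - (LINT x|K. (1 + cos (0 * Re (W x) + pi / 2)) * indicator B (Im (W x))))
         + \<i> * complex_of_real ((LINT x|K. (1 + cos (s * Re (W x) + - pi / 2)) * indicator B (Im (W x))) - (LINT x|K. (1 + cos (0 * Re (W x) + pi / 2)) * indicator B (Im (W x))))"
      if K: "prob_space K" and W[measurable]: "W \<in> borel_measurable K" for K and W :: "'c \<Rightarrow> complex" and s
    proof -
      interpret prob_space K by fact
      have cos_shift: "cos (y + - pi / 2) = sin y" for y :: real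
        by (simp add: cos_diff)
      have i1: "integrable K (\<lambda>x. (1 + cos (s * Re (W x) + r)) * indicator B (Im (W x)))" for s r
      proof (rule integrable_const_bound[of _ 2])
        show "AE x in K. norm ((1 + cos (s * Re (W x) + r)) * indicator B (Im (W x))) \<le> 2"
          using cos_bound by (auto simp: indicator_def)
      qed measurable
      have i2: "integrable K (\<lambda>x. h (s * Re (W x)) * indicator B (Im (W x)))"
        if "h = cos \<or> h = sin" for h :: "real \<Rightarrow> real"
        by (rule integrable_const_bound[of _ 1]) (use that in \<open>auto simp: indicator_def\<close>)
      have "complex_of_real (indicator B (Im (W x))) * iexp (s * Re (W x))
        = complex_of_real (cos (s * Re (W x)) * indicator B (Im (W x)))
          + \<i> * complex_of_real (sin (s * Re (W x)) * indicator B (Im (W x)))" for x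
        unfolding cis_conv_exp[symmetric] by (simp add: complex_eq_iff)
      then have "(CLINT x|K. complex_of_real (indicator B (Im (W x))) * iexp (s * Re (W x)))
        = complex_of_real (LINT x|K. cos (s * Re (W x)) * indicator B (Im (W x)))
          + \<i> * complex_of_real (LINT x|K. sin (s * Re (W x)) * indicator B (Im (W x)))"
        by (simp only: Bochner_Integration.integral_add integrable_mult_right integrable_of_real
            integral_mult_right_zero integral_complex_of_real i2[OF disjI1[OF refl]] i2[OF disjI2[OF refl]])
      also have "(LINT x|K. cos (s * Re (W x)) * indicator B (Im (W x)))
        = (LINT x|K. (1 + cos (s * Re (W x) + 0)) * indicator B (Im (W x))) - (LINT x|K. (1 + cos (0 * Re (W x) + pi / 2)) * indicator B (Im (W x)))"
        by (subst Bochner_Integration.integral_diff[symmetric, OF i1 i1])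
           (auto intro!: Bochner_Integration.integral_cong simp: algebra_simps)
      also have "(LINT x|K. sin (s * Re (W x)) * indicator B (Im (W x)))
        = (LINT x|K. (1 + cos (s * Re (W x) + - pi / 2)) * indicator B (Im (W x))) - (LINT x|K. (1 + cos (0 * Re (W x) + pi / 2)) * indicator B (Im (W x)))"
        by (subst Bochner_Integration.integral_diff[symmetric, OF i1 i1], simp only: cos_shift)
           (auto intro!: Bochner_Integration.integral_cong simp: algebra_simps)
      finally show ?thesis .
    qed
    show "(CLINT x|M. complex_of_real (indicator B (Im (X x))) * iexp (s * Re (X x)))
       = (CLINT x|N. complex_of_real (indicator B (Im (Y x))) * iexp (s * Re (Y x)))" for s
      unfolding split[OF M X] split[OF N Y] cos_Im[OF that(2)] ..
    show "integrable M (\<lambda>x. indicator B (Im (X x)) :: real)"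
      by (rule M.integrable_const_bound[of _ 1]) (auto simp: indicator_def)
    show "integrable N (\<lambda>x. indicator B (Im (Y x)) :: real)"
      by (rule N.integrable_const_bound[of _ 1]) (auto simp: indicator_def)
  qed auto
  have rect: "emeasure K {x \<in> space K. Re (W x) \<in> A \<and> Im (W x) \<in> B} = ennreal (LINT x|K. indicator B (Im (W x)) * indicator A (Re (W x)))"
    if K: "prob_space K" and W[measurable]: "W \<in> borel_measurable K" and [measurable]: "A \<in> sets borel" "B \<in> sets borel"
    for K and W :: "'c \<Rightarrow> complex" and A B
  proof -
    interpret prob_space K by fact
    have "(LINT x|K. indicator B (Im (W x)) * indicator A (Re (W x)))
        = (LINT x|K. indicator {x \<in> space K. Re (W x) \<in> A \<and> Im (W x) \<in> B} x :: real)"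
      by (rule Bochner_Integration.integral_cong) (auto simp: indicator_def)
    also have "\<dots> = prob {x \<in> space K. Re (W x) \<in> A \<and> Im (W x) \<in> B}"
      by (subst Bochner_Integration.integral_indicator) (auto intro!: arg_cong[of _ _ prob])
    finally show ?thesis by (simp add: emeasure_eq_measure)
  qed
  define P where "P = distr M (borel \<Otimes>\<^sub>M borel) (\<lambda>\<omega>. (Re (X \<omega>), Im (X \<omega>)))"
  define Q where "Q = distr N (borel \<Otimes>\<^sub>M borel) (\<lambda>\<omega>. (Re (Y \<omega>), Im (Y \<omega>)))"
  have "P = Q"
  proof (rule measure_eqI_generator_eq[OF Int_stable_pair_measure_generator])
    show "{a \<times> b |a b. a \<in> sets (borel :: real measure) \<and> b \<in> sets (borel :: real measure)} \<subseteq> Pow UNIV" by auto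
    show "sets P = sigma_sets UNIV {a \<times> b |a b. a \<in> sets borel \<and> b \<in> sets borel}"
      "sets Q = sigma_sets UNIV {a \<times> b |a b. a \<in> sets borel \<and> b \<in> sets borel}"
      by (simp_all add: P_def Q_def sets_pair_measure)
    show "range (\<lambda>i::nat. UNIV \<times> UNIV) \<subseteq> {a \<times> b |a b. a \<in> sets (borel :: real measure) \<and> b \<in> sets (borel :: real measure)}"
      by (rule image_subsetI, intro CollectI exI conjI, rule refl) auto
    show "(\<Union>i::nat. UNIV \<times> UNIV) = (UNIV :: (real \<times> real) set)" by auto
    have "prob_space P" unfolding P_def by (rule M.prob_space_distr) auto
    then interpret P: prob_space P .
    show "emeasure P (UNIV \<times> UNIV) \<noteq> \<infinity>" by simp
    fix C assume "C \<in> {a \<times> b |a b. a \<in> sets (borel :: real measure) \<and> b \<in> sets (borel :: real measure)}"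
    then obtain A B where C: "C = A \<times> B" and AB[measurable]: "A \<in> sets borel" "B \<in> sets borel" by blast
    have "emeasure P C = emeasure M {x \<in> space M. Re (X x) \<in> A \<and> Im (X x) \<in> B}"
      unfolding P_def C by (subst emeasure_distr) (auto intro!: arg_cong[of _ _ "emeasure M"])
    also have "\<dots> = emeasure N {x \<in> space N. Re (Y x) \<in> A \<and> Im (Y x) \<in> B}"
      unfolding rect[OF M X AB] rect[OF N Y AB] ind[OF AB] ..
    also have "\<dots> = emeasure Q C"
      unfolding Q_def C by (subst emeasure_distr) (auto intro!: arg_cong[of _ _ "emeasure N"])
    finally show "emeasure P C = emeasure Q C" .
  qed
  then have "distr P borel (\<lambda>(x, y). complex_of_real x + \<i> * complex_of_real y)
      = distr Q borel (\<lambda>(x, y). complex_of_real x + \<i> * complex_of_real y)" by simp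
  then show ?thesis
    unfolding P_def Q_def
    by (subst (asm) distr_distr, simp, simp, subst (asm) distr_distr) (simp_all add: comp_def flip: complex_eq)
qed

section \<open>Processes with independent increments\<close>

lemma (in prob_space) indep_vars_reindex_inj:
  assumes "inj_on f I" "indep_vars M' X (f ` I)"
  shows "indep_vars (\<lambda>i. M' (f i)) (\<lambda>i. X (f i)) I"
  unfolding indep_vars_def2 indep_sets_def
proof (intro conjI ballI allI impI)
  show "random_variable (M' (f i)) (X (f i))" if "i \<in> I" for i
    using assms(2) that by (auto simp: indep_vars_def2)
  then show "{X (f i) -` A \<inter> space M |A. A \<in> sets (M' (f i))} \<subseteq> events" if "i \<in> I" for i
    using that by (auto intro: measurable_sets)
  fix J A assume J: "J \<subseteq> I" "J \<noteq> {}" "finite J"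
    and A: "A \<in> (\<Pi> i\<in>J. {X (f i) -` A \<inter> space M |A. A \<in> sets (M' (f i))})"
  have inj: "inj_on f J" using assms(1) J(1) by (rule inj_on_subset)
  define A' where "A' = A \<circ> the_inv_into J f"
  have A': "A' (f j) = A j" if "j \<in> J" for j
    using that by (simp add: A'_def the_inv_into_f_f[OF inj])
  have "A' \<in> (\<Pi> i\<in>f ` J. {X i -` A \<inter> space M |A. A \<in> sets (M' i)})"
    using A A' by (auto simp: Pi_iff)
  moreover have "indep_sets (\<lambda>i. {X i -` A \<inter> space M |A. A \<in> sets (M' i)}) (f ` I)"
    using assms(2) by (simp add: indep_vars_def2)
  ultimately have "prob (\<Inter>j\<in>f ` J. A' j) = (\<Prod>j\<in>f ` J. prob (A' j))"
    using J by (intro indep_setsD) auto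
  then show "prob (\<Inter>j\<in>J. A j) = (\<Prod>j\<in>J. prob (A j))"
    using A' by (simp add: prod.reindex[OF inj] cong: INF_cong_simp)
qed

text \<open>The almost sure start at 0 is included so that values are sums of increments. Only times
  up to \<open>t\<close> count, as the comparison is made there.\<close>

definition independent_increments :: "'w measure \<Rightarrow> real \<Rightarrow> (real \<Rightarrow> 'w \<Rightarrow> complex) \<Rightarrow> bool" where
  "independent_increments M t X \<longleftrightarrow>
     (\<forall>s\<in>{0..t}. X s \<in> borel_measurable M) \<and> (AE \<omega> in M. X 0 \<omega> = 0) \<and>
     (\<forall>(n::nat) (\<tau>::nat \<Rightarrow> real). 0 \<le> \<tau> 0 \<and> (\<forall>i<n. \<tau> i < \<tau> (Suc i)) \<and> \<tau> n \<le> t \<longrightarrow>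
        prob_space.indep_vars M (\<lambda>_. borel) (\<lambda>i \<omega>. X (\<tau> (Suc i)) \<omega> - X (\<tau> i) \<omega>) {..<n})"

text \<open>Almost surely \<open>X j\<close> is the sum of the first \<open>k j\<close> increments
  over the partition \<tau>, where \<open>k j\<close> is the position of the time \<open>j\<close>.
  The event is thus one about the increments, whose joint law is the product of their laws.\<close>

lemma emeasure_independent_increments:
  assumes M: "prob_space M" and X: "independent_increments M t X"
    and \<tau>: "\<tau> 0 = 0" "\<And>i. i < n \<Longrightarrow> \<tau> i < \<tau> (Suc i)" "\<tau> n \<le> t" and n: "0 < n"
    and J: "finite J" "\<And>j. j \<in> J \<Longrightarrow> k j \<le> n \<and> \<tau> (k j) = j"
    and A: "\<And>j. j \<in> J \<Longrightarrow> A j \<in> sets borel"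
  shows "emeasure M {\<omega> \<in> space M. \<forall>j\<in>J. X j \<omega> \<in> A j}
    = emeasure (PiM {..<n} (\<lambda>i. distr M borel (\<lambda>\<omega>. X (\<tau> (Suc i)) \<omega> - X (\<tau> i) \<omega>)))
        {d \<in> space (PiM {..<n} (\<lambda>_. borel)). \<forall>j\<in>J. (\<Sum>i<k j. d i) \<in> A j}"
proof -
  interpret prob_space M by fact
  have mono: "\<tau> i \<le> \<tau> j" if "i \<le> j" "j \<le> n" for i j
    using that
  proof (induction j)
    case (Suc j)
    then show ?case using \<tau>(2)[of j] by (cases "i = Suc j") auto
  qed auto
  have \<tau>t: "\<tau> i \<in> {0..t}" if "i \<le> n" for i
    using mono[of 0 i] mono[of i n] \<tau> that by auto
  have X\<tau>: "X (\<tau> i) \<in> borel_measurable M" if "i \<le> n" for i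
    using X \<tau>t[OF that] by (simp add: independent_increments_def)
  define D where "D = (\<lambda>i \<omega>. X (\<tau> (Suc i)) \<omega> - X (\<tau> i) \<omega>)"
  define B where "B = {d \<in> space (PiM {..<n} (\<lambda>_. borel :: complex measure)). \<forall>j\<in>J. (\<Sum>i<k j. d i) \<in> A j}"
  have D: "D i \<in> borel_measurable M" if "i < n" for i
    unfolding D_def using that by (intro borel_measurable_diff X\<tau>) auto
  have B: "B \<in> sets (PiM {..<n} (\<lambda>_. borel))"
    unfolding B_def
  proof (intro sets.sets_Collect_countable_All' countable_finite J(1))
    fix j assume j: "j \<in> J"
    have "(\<lambda>d. \<Sum>i<k j. d i) \<in> borel_measurable (PiM {..<n} (\<lambda>_. borel :: complex measure))"
      using J(2)[OF j] by (intro borel_measurable_sum measurable_component_singleton) auto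
    from measurable_sets[OF this A[OF j]]
    show "{d \<in> space (PiM {..<n} (\<lambda>_. borel)). (\<Sum>i<k j. d i) \<in> A j} \<in> sets (PiM {..<n} (\<lambda>_. borel))"
      by (simp add: vimage_def Int_def conj_commute)
  qed
  have Dr: "(\<lambda>\<omega>. \<lambda>i\<in>{..<n}. D i \<omega>) \<in> measurable M (PiM {..<n} (\<lambda>_. borel))"
    by (intro measurable_restrict D) auto
  have tel: "(\<Sum>i<m. D i \<omega>) = X (\<tau> m) \<omega> - X 0 \<omega>" for m \<omega>
    unfolding D_def using sum_lessThan_telescope[of "\<lambda>i. X (\<tau> i) \<omega>" m] by (simp add: \<tau>(1))
  have "AE \<omega> in M. X 0 \<omega> = 0" using X by (simp add: independent_increments_def)
  then have "emeasure M {\<omega> \<in> space M. \<forall>j\<in>J. X j \<omega> \<in> A j}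
      = emeasure M ((\<lambda>\<omega>. \<lambda>i\<in>{..<n}. D i \<omega>) -` B \<inter> space M)"
  proof (intro emeasure_eq_AE)
    assume "AE \<omega> in M. X 0 \<omega> = 0"
    then show "AE \<omega> in M. (\<omega> \<in> {\<omega> \<in> space M. \<forall>j\<in>J. X j \<omega> \<in> A j})
        = (\<omega> \<in> (\<lambda>\<omega>. \<lambda>i\<in>{..<n}. D i \<omega>) -` B \<inter> space M)"
    proof (rule AE_mp, intro AE_I2 impI)
      fix \<omega> assume \<omega>: "\<omega> \<in> space M" "X 0 \<omega> = 0"
      have "(\<Sum>i<k j. (\<lambda>i\<in>{..<n}. D i \<omega>) i) = X j \<omega>" if "j \<in> J" for j
      proof -
        have "(\<Sum>i<k j. (\<lambda>i\<in>{..<n}. D i \<omega>) i) = (\<Sum>i<k j. D i \<omega>)"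
          using J(2)[OF that] by (intro sum.cong) auto
        then show ?thesis using tel[of \<omega> "k j"] J(2)[OF that] \<omega>(2) by simp
      qed
      then show "(\<omega> \<in> {\<omega> \<in> space M. \<forall>j\<in>J. X j \<omega> \<in> A j})
        = (\<omega> \<in> (\<lambda>\<omega>. \<lambda>i\<in>{..<n}. D i \<omega>) -` B \<inter> space M)"
        using \<omega>(1) by (simp add: B_def space_PiM)
    qed
    show "{\<omega> \<in> space M. \<forall>j\<in>J. X j \<omega> \<in> A j} \<in> events"
    proof (intro sets.sets_Collect_countable_All' countable_finite J(1))
      fix j assume j: "j \<in> J"
      then have "X j \<in> borel_measurable M" using X\<tau>[of "k j"] J(2)[OF j] by simp
      from measurable_sets[OF this A[OF j]]
      show "{\<omega> \<in> space M. X j \<omega> \<in> A j} \<in> events"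
        by (simp add: vimage_def Int_def conj_commute)
    qed
    show "(\<lambda>\<omega>. \<lambda>i\<in>{..<n}. D i \<omega>) -` B \<inter> space M \<in> events"
      by (rule measurable_sets[OF Dr B])
  qed
  also have "\<dots> = emeasure (distr M (PiM {..<n} (\<lambda>_. borel)) (\<lambda>\<omega>. \<lambda>i\<in>{..<n}. D i \<omega>)) B"
    by (rule emeasure_distr[OF Dr B, symmetric])
  also have "distr M (PiM {..<n} (\<lambda>_. borel)) (\<lambda>\<omega>. \<lambda>i\<in>{..<n}. D i \<omega>) = PiM {..<n} (\<lambda>i. distr M borel (D i))"
  proof (rule iffD1[OF indep_vars_iff_distr_eq_PiM'])
    show "{..<n} \<noteq> {}" using n by auto
    show "indep_vars (\<lambda>_. borel) D {..<n}"
      using X \<tau> unfolding independent_increments_def D_def by simp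
  qed (use D in auto)
  finally show ?thesis unfolding D_def B_def .
qed

text \<open>Events at finitely many times determine a law on the product space, and by the preceding
  lemma their probabilities depend on the laws of the increments alone.\<close>

lemma independent_increments_law_unique:
  assumes M: "prob_space M" and N: "prob_space N" and t: "0 < t"
    and X: "independent_increments M t X" and Y: "independent_increments N t Y"
    and eq: "\<And>r s. 0 \<le> r \<Longrightarrow> r < s \<Longrightarrow> s \<le> t \<Longrightarrow>
      distr M borel (\<lambda>\<omega>. X s \<omega> - X r \<omega>) = distr N borel (\<lambda>\<omega>. Y s \<omega> - Y r \<omega>)"
  shows "distr M (PiM {0..t} (\<lambda>_. borel)) (\<lambda>\<omega>. \<lambda>s\<in>{0..t}. X s \<omega>)
    = distr N (PiM {0..t} (\<lambda>_. borel)) (\<lambda>\<omega>. \<lambda>s\<in>{0..t}. Y s \<omega>)" (is "?P = ?Q")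
proof (rule measure_eqI_PiM_infinite)
  interpret M: prob_space M by fact
  interpret N: prob_space N by fact
  have Xr: "(\<lambda>\<omega>. \<lambda>s\<in>{0..t}. X s \<omega>) \<in> measurable M (PiM {0..t} (\<lambda>_. borel))"
    using X by (intro measurable_restrict) (simp add: independent_increments_def)
  have Yr: "(\<lambda>\<omega>. \<lambda>s\<in>{0..t}. Y s \<omega>) \<in> measurable N (PiM {0..t} (\<lambda>_. borel))"
    using Y by (intro measurable_restrict) (simp add: independent_increments_def)
  show "finite_measure ?P" by (rule M.finite_measure_distr[OF Xr])
  fix A J assume J: "finite J" "J \<subseteq> {0..t}" and A: "\<And>i. i \<in> J \<Longrightarrow> A i \<in> sets (borel :: complex measure)"
  \<comment> \<open>Inserting 0 makes the partition start at 0; inserting \<open>t > 0\<close>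
    guarantees at least one increment.\<close>
  define L where "L = sorted_list_of_set (insert 0 (insert t J))"
  define n where "n = length L - 1"
  define \<tau> where "\<tau> = (\<lambda>i. L ! i)"
  have setL: "set L = insert 0 (insert t J)" unfolding L_def using J(1) by (intro set_sorted_list_of_set) auto
  have strict: "sorted_wrt (<) L" unfolding L_def by simp
  have len: "length L = Suc n"
    using setL by (cases L) (auto simp: n_def)
  have \<tau>lt: "\<tau> i < \<tau> j" if "i < j" "j \<le> n" for i j
    unfolding \<tau>_def using sorted_wrt_nth_less[OF strict] that len by simp
  have \<tau>in: "\<tau> i \<in> {0..t}" if "i \<le> n" for i
  proof -
    have "\<tau> i \<in> set L" unfolding \<tau>_def using that len by (intro nth_mem) auto
    then show ?thesis using setL J(2) t by auto
  qed
  have surj: "\<exists>k\<le>n. \<tau> k = j" if "j \<in> set L" for j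
    using that len by (auto simp: in_set_conv_nth \<tau>_def less_Suc_eq_le)
  have \<tau>0: "\<tau> 0 = 0"
  proof -
    obtain k where "k \<le> n" "\<tau> k = 0" using surj[of 0] setL by auto
    then show ?thesis using \<tau>lt[of 0 k] \<tau>in[of 0] by (cases "k = 0") auto
  qed
  have n0: "0 < n"
  proof (rule ccontr)
    assume "\<not> 0 < n"
    moreover obtain k where "k \<le> n" "\<tau> k = t" using surj[of t] setL by auto
    ultimately show False using \<tau>0 t by simp
  qed
  define k where "k j = (SOME i. i \<le> n \<and> \<tau> i = j)" for j
  have k: "k j \<le> n \<and> \<tau> (k j) = j" if "j \<in> J" for j
    unfolding k_def by (rule someI_ex) (use surj[of j] setL that in auto)
  have \<tau>n: "\<tau> n \<le> t" using \<tau>in[of n] by simp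
  have emb: "emeasure (distr K (PiM {0..t} (\<lambda>_. borel)) (\<lambda>\<omega>. \<lambda>s\<in>{0..t}. Z s \<omega>))
       (prod_emb {0..t} (\<lambda>_. borel) J (Pi\<^sub>E J A)) = emeasure K {\<omega> \<in> space K. \<forall>j\<in>J. Z j \<omega> \<in> A j}"
    if Z: "(\<lambda>\<omega>. \<lambda>s\<in>{0..t}. Z s \<omega>) \<in> measurable K (PiM {0..t} (\<lambda>_. borel))"
    for K and Z :: "real \<Rightarrow> 'c \<Rightarrow> complex"
  proof -
    have "(\<lambda>\<omega>. \<lambda>s\<in>{0..t}. Z s \<omega>) -` prod_emb {0..t} (\<lambda>_. borel) J (Pi\<^sub>E J A) \<inter> space K
        = {\<omega> \<in> space K. \<forall>j\<in>J. Z j \<omega> \<in> A j}"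
      using J(2) by (auto simp: prod_emb_def PiE_iff subset_iff)
    then show ?thesis
      using Z J A by (subst emeasure_distr) (auto intro!: sets_PiM_I)
  qed
  have "PiM {..<n} (\<lambda>i. distr M borel (\<lambda>\<omega>. X (\<tau> (Suc i)) \<omega> - X (\<tau> i) \<omega>))
      = PiM {..<n} (\<lambda>i. distr N borel (\<lambda>\<omega>. Y (\<tau> (Suc i)) \<omega> - Y (\<tau> i) \<omega>))"
    using \<tau>in \<tau>lt by (intro PiM_cong eq) auto
  then show "emeasure ?P (prod_emb {0..t} (\<lambda>_. borel) J (Pi\<^sub>E J A))
      = emeasure ?Q (prod_emb {0..t} (\<lambda>_. borel) J (Pi\<^sub>E J A))"
    unfolding emb[OF Xr] emb[OF Yr]
    using emeasure_independent_increments[where k = k and \<tau> = \<tau> and J = J and A = A, OF M X \<tau>0 \<tau>lt \<tau>n n0 J(1) k A]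
      emeasure_independent_increments[where k = k and \<tau> = \<tau> and J = J and A = A, OF N Y \<tau>0 \<tau>lt \<tau>n n0 J(1) k A]
    by simp
qed auto

section \<open>Reversed Brownian motion\<close>

text \<open>Continuity is not an event of a product over uncountably many times, so the product
  sigma-algebra is pulled back to the continuous paths instead of being restricted to a measurable
  subset.\<close>

definition path_space :: "real \<Rightarrow> (real \<Rightarrow> complex) measure" where
  "path_space t = vimage_algebra {u. continuous_on {0..} u} (\<lambda>u. restrict u {0..t}) (PiM {0..t} (\<lambda>_. borel))"

lemma space_path_space [simp]: "space (path_space t) = {u. continuous_on {0..} u}"
  by (simp add: path_space_def)

lemma continuous_driver_path_space:
  assumes "0 \<le> t"
  shows "continuous_driver (path_space t) (\<lambda>s u. u s) t"
proof
  have "(\<lambda>u. restrict u {0..t}) \<in> measurable (path_space t) (PiM {0..t} (\<lambda>_. borel :: complex measure))"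
    unfolding path_space_def by (rule measurable_vimage_algebra1) (auto simp: space_PiM)
  note R = measurable_compose[OF this measurable_component_singleton]
  show "(\<lambda>u. u s) \<in> borel_measurable (path_space t)" if "0 \<le> s" "s \<le> t" for s
    using R[of s] that by simp
qed (use assms in auto)

text \<open>On continuous paths every event of \<Phi> is the trace of an event \<open>B\<close> of
  the product space. Both processes have continuous paths, so its probability is that of
  \<open>B\<close> under the common law.\<close>

lemma distr_path_functional_eq:
  fixes X :: "real \<Rightarrow> 'w \<Rightarrow> complex" and Y :: "real \<Rightarrow> 'v \<Rightarrow> complex"
  assumes X: "continuous_driver M X t" and Y: "continuous_driver N Y t"
    and law: "distr M (PiM {0..t} (\<lambda>_. borel)) (\<lambda>\<omega>. \<lambda>s\<in>{0..t}. X s \<omega>)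
      = distr N (PiM {0..t} (\<lambda>_. borel)) (\<lambda>\<omega>. \<lambda>s\<in>{0..t}. Y s \<omega>)"
    and \<Phi>: "\<Phi> \<in> measurable (path_space t) E"
  shows "distr M E (\<lambda>\<omega>. \<Phi> (\<lambda>s. X s \<omega>)) = distr N E (\<lambda>\<omega>. \<Phi> (\<lambda>s. Y s \<omega>))"
proof -
  have path: "(\<lambda>\<omega>. \<lambda>s\<in>{0..t}. Z s \<omega>) \<in> measurable K (PiM {0..t} (\<lambda>_. borel))"
      "(\<lambda>\<omega> s. Z s \<omega>) \<in> measurable K (path_space t)"
    if "continuous_driver K Z t" for K and Z :: "real \<Rightarrow> 'c \<Rightarrow> complex"
  proof -
    interpret continuous_driver K Z t by fact
    show *: "(\<lambda>\<omega>. \<lambda>s\<in>{0..t}. Z s \<omega>) \<in> measurable K (PiM {0..t} (\<lambda>_. borel))"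
      by (intro measurable_restrict measurable_driver) auto
    show "(\<lambda>\<omega> s. Z s \<omega>) \<in> measurable K (path_space t)"
      unfolding path_space_def
      by (rule measurable_vimage_algebra2) (use continuous_path * in auto)
  qed
  have pull: "emeasure (distr K E (\<lambda>\<omega>. \<Phi> (\<lambda>s. Z s \<omega>))) A
      = emeasure (distr K (PiM {0..t} (\<lambda>_. borel)) (\<lambda>\<omega>. \<lambda>s\<in>{0..t}. Z s \<omega>)) B"
    if Z: "continuous_driver K Z t" and A: "A \<in> sets E"
      and B: "B \<in> sets (PiM {0..t} (\<lambda>_. borel))"
        "\<Phi> -` A \<inter> {u. continuous_on {0..} u} = (\<lambda>u. restrict u {0..t}) -` B \<inter> {u. continuous_on {0..} u}"
    for K A B and Z :: "real \<Rightarrow> 'c \<Rightarrow> complex"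
  proof -
    interpret continuous_driver K Z t by fact
    have "\<Phi> (\<lambda>s. Z s \<omega>) \<in> A \<longleftrightarrow> (\<lambda>s\<in>{0..t}. Z s \<omega>) \<in> B" if "\<omega> \<in> space K" for \<omega>
      using B(2) continuous_path[OF that] by blast
    then have "(\<lambda>\<omega>. \<Phi> (\<lambda>s. Z s \<omega>)) -` A \<inter> space K = (\<lambda>\<omega>. \<lambda>s\<in>{0..t}. Z s \<omega>) -` B \<inter> space K"
      by blast
    then show ?thesis
      using emeasure_distr[OF path(1)[OF Z] B(1)] emeasure_distr[OF measurable_compose[OF path(2)[OF Z] \<Phi>] A]
      by simp
  qed
  show ?thesis
  proof (rule measure_eqI)
    fix A assume "A \<in> sets (distr M E (\<lambda>\<omega>. \<Phi> (\<lambda>s. X s \<omega>)))"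
    then have A: "A \<in> sets E" by simp
    have "\<Phi> -` A \<inter> {u. continuous_on {0..} u} \<in> sets (path_space t)"
      using measurable_sets[OF \<Phi> A] by simp
    then obtain B where "B \<in> sets (PiM {0..t} (\<lambda>_. borel :: complex measure))"
      "\<Phi> -` A \<inter> {u. continuous_on {0..} u} = (\<lambda>u. restrict u {0..t}) -` B \<inter> {u. continuous_on {0..} u}"
      unfolding path_space_def by (subst (asm) sets_vimage_algebra2) (auto simp: space_PiM)
    from pull[OF X A this] pull[OF Y A this]
    show "emeasure (distr M E (\<lambda>\<omega>. \<Phi> (\<lambda>s. X s \<omega>))) A = emeasure (distr N E (\<lambda>\<omega>. \<Phi> (\<lambda>s. Y s \<omega>))) A"
      by (simp add: law)
  qed simp
qed

lemma continuous_driver_brownian: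
  assumes "complex_brownian_motion M S U" "0 \<le> t"
  shows "continuous_driver M U t"
  using assms by unfold_locales (auto simp: complex_brownian_motion_def)

lemma independent_increments_brownian:
  assumes "complex_brownian_motion M S U" "0 \<le> t"
  shows "independent_increments M t U"
  using assms unfolding complex_brownian_motion_def independent_increments_def by auto

text \<open>The increments of the reversed driver over \<tau> are \<open>- i\<close> times those of
  \<open>U\<close> over the reflected partition \<sigma>, in the opposite order.\<close>

lemma independent_increments_reversed_driver:
  assumes bm: "complex_brownian_motion M S U" and t: "0 \<le> t"
  shows "independent_increments M t (\<lambda>s \<omega>. reversed_driver t (\<lambda>r. U r \<omega>) s)"
proof -
  interpret prob_space M using bm by (simp add: complex_brownian_motion_def)
  interpret rev: continuous_driver M "\<lambda>s \<omega>. reversed_driver t (\<lambda>r. U r \<omega>) s" t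
    by (intro continuous_driver.continuous_driver_reversed continuous_driver_brownian[OF bm t])
  have "indep_vars (\<lambda>_. borel)
      (\<lambda>i \<omega>. reversed_driver t (\<lambda>r. U r \<omega>) (\<tau> (Suc i)) - reversed_driver t (\<lambda>r. U r \<omega>) (\<tau> i)) {..<n}"
    if \<tau>: "0 \<le> \<tau> 0" "\<forall>i<n. \<tau> i < \<tau> (Suc i)" "\<tau> n \<le> t" for n :: nat and \<tau> :: "nat \<Rightarrow> real"
  proof -
    have \<tau>t: "\<tau> i \<le> t" if "i \<le> n" for i
      using that \<tau>(3)
    proof (induction rule: inc_induct)
      case (step i)
      then show ?case using \<tau>(2) by force
    qed
    \<comment> \<open>The increment from \<tau> i to \<tau> (i + 1) matches the one of \<sigma> with
      index n - (i + 1); this index is \<open>f i\<close>.\<close>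
    define \<sigma> where "\<sigma> = (\<lambda>j. t - \<tau> (n - j))"
    define f where "f = (\<lambda>i. n - Suc i)"
    have f: "f ` {..<n} = {..<n}" "inj_on f {..<n}"
    proof -
      show inj: "inj_on f {..<n}" by (auto simp: f_def inj_on_def)
      show "f ` {..<n} = {..<n}" by (rule endo_inj_surj[OF _ _ inj]) (auto simp: f_def)
    qed
    have "0 \<le> \<sigma> 0 \<and> (\<forall>i<n. \<sigma> i < \<sigma> (Suc i))"
    proof (intro conjI allI impI)
      show "0 \<le> \<sigma> 0" using \<tau>(3) by (simp add: \<sigma>_def)
      fix i assume "i < n"
      then have "n - i = Suc (n - Suc i)" by simp
      then show "\<sigma> i < \<sigma> (Suc i)" using \<tau>(2) \<open>i < n\<close> by (simp add: \<sigma>_def)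
    qed
    then have "indep_vars (\<lambda>_. borel) (\<lambda>i \<omega>. U (\<sigma> (Suc i)) \<omega> - U (\<sigma> i) \<omega>) (f ` {..<n})"
      using bm unfolding complex_brownian_motion_def f by blast
    from indep_vars_reindex_inj[OF f(2) this]
    have "indep_vars (\<lambda>_. borel) (\<lambda>i \<omega>. - \<i> * (U (\<sigma> (Suc (f i))) \<omega> - U (\<sigma> (f i)) \<omega>)) {..<n}"
      by (rule indep_vars_compose2[where Y = "\<lambda>_ z. - \<i> * z"]) auto
    then show ?thesis
    proof (rule indep_vars_cong[THEN iffD1, rotated -1])
      fix i assume "i \<in> {..<n}"
      then have "Suc (f i) = n - i" "n - Suc (f i) = i" "n - f i = Suc i" "\<tau> i \<le> t" "\<tau> (Suc i) \<le> t"
        using \<tau>t by (auto simp: f_def)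
      then show "(\<lambda>\<omega>. - \<i> * (U (\<sigma> (Suc (f i))) \<omega> - U (\<sigma> (f i)) \<omega>)) =
        (\<lambda>\<omega>. reversed_driver t (\<lambda>r. U r \<omega>) (\<tau> (Suc i)) - reversed_driver t (\<lambda>r. U r \<omega>) (\<tau> i))"
        by (auto simp: \<sigma>_def reversed_driver_def algebra_simps)
    qed auto
  qed
  then show ?thesis
    unfolding independent_increments_def using rev.measurable_driver t
    by (auto simp: reversed_driver_def)
qed

text \<open>The increment is \<open>- i\<close> times that of \<open>U\<close> from
  \<open>t - s\<close> to \<open>t - r\<close>, an interval of the same length. Linear functionals
  of both sides are normal, so comparing variances is enough.\<close>

lemma reversed_brownian_increment_law:
  fixes a b c :: real
  assumes U: "complex_brownian_motion M (vector [vector [a, c], vector [c, b]]) U"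
    and V: "complex_brownian_motion N (vector [vector [b, - c], vector [- c, a]]) V"
    and rs: "0 \<le> r" "r < s" "s \<le> t"
  shows "distr M borel (\<lambda>\<omega>. reversed_driver t (\<lambda>q. U q \<omega>) s - reversed_driver t (\<lambda>q. U q \<omega>) r)
    = distr N borel (\<lambda>\<omega>. V s \<omega> - V r \<omega>)"
proof (rule cramer_wold_complex)
  show "prob_space M" "prob_space N" using U V by (auto simp: complex_brownian_motion_def)
  have t: "0 \<le> t" using rs by simp
  interpret rev: continuous_driver M "\<lambda>s \<omega>. reversed_driver t (\<lambda>r. U r \<omega>) s" t
    by (intro continuous_driver.continuous_driver_reversed continuous_driver_brownian[OF U t])
  interpret V: continuous_driver N V t by (rule continuous_driver_brownian[OF V t])
  show "(\<lambda>\<omega>. reversed_driver t (\<lambda>q. U q \<omega>) s - reversed_driver t (\<lambda>q. U q \<omega>) r) \<in> borel_measurable M"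
    using rs by (intro borel_measurable_diff rev.measurable_driver) auto
  show "(\<lambda>\<omega>. V s \<omega> - V r \<omega>) \<in> borel_measurable N"
    using rs by (intro borel_measurable_diff V.measurable_driver) auto
  fix p q :: real
  \<comment> \<open>The functional (p, q) of - i w is the functional (- q, p) of w; the quadratic
    form of the first matrix at \<open>x\<close> equals that of the second at
    \<open>y\<close>.\<close>
  define x y :: "real^2" where "x = vector [- q, p]" and "y = vector [p, q]"
  let ?S = "vector [vector [a, c], vector [c, b]] :: real^2^2"
  let ?T = "vector [vector [b, - c], vector [- c, a]] :: real^2^2"
  have xy: "x $ 1 = - q" "x $ 2 = p" "y $ 1 = p" "y $ 2 = q" by (auto simp: x_def y_def)
  have var: "x \<bullet> (?S *v x) = y \<bullet> (?T *v y)"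
    by (simp add: inner_vec_def matrix_vector_mult_def sum_2 xy algebra_simps)
  have "(\<lambda>\<omega>. p * Re (reversed_driver t (\<lambda>q. U q \<omega>) s - reversed_driver t (\<lambda>q. U q \<omega>) r) +
          q * Im (reversed_driver t (\<lambda>q. U q \<omega>) s - reversed_driver t (\<lambda>q. U q \<omega>) r))
      = (\<lambda>\<omega>. x $ 1 * Re (U (t - r) \<omega> - U (t - s) \<omega>) + x $ 2 * Im (U (t - r) \<omega> - U (t - s) \<omega>))"
    using rs by (auto simp: reversed_driver_def xy algebra_simps)
  moreover have "distr M borel (\<lambda>\<omega>. x $ 1 * Re (U (t - r) \<omega> - U (t - s) \<omega>) + x $ 2 * Im (U (t - r) \<omega> - U (t - s) \<omega>))
      = centered_normal ((t - r - (t - s)) * (x \<bullet> (?S *v x)))"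
    using U rs unfolding complex_brownian_motion_def by simp
  moreover have "distr N borel (\<lambda>\<omega>. y $ 1 * Re (V s \<omega> - V r \<omega>) + y $ 2 * Im (V s \<omega> - V r \<omega>))
      = centered_normal ((s - r) * (y \<bullet> (?T *v y)))"
    using V rs unfolding complex_brownian_motion_def by simp
  ultimately show "distr M borel (\<lambda>\<omega>. p * Re (reversed_driver t (\<lambda>q. U q \<omega>) s - reversed_driver t (\<lambda>q. U q \<omega>) r) +
          q * Im (reversed_driver t (\<lambda>q. U q \<omega>) s - reversed_driver t (\<lambda>q. U q \<omega>) r))
      = distr N borel (\<lambda>\<omega>. p * Re (V s \<omega> - V r \<omega>) + q * Im (V s \<omega> - V r \<omega>))"
    by (simp add: xy var)
qed

theorem proposition1p5:
  fixes a b c t :: real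
    and M :: "'w measure" and U :: "real \<Rightarrow> 'w \<Rightarrow> complex"
    and N :: "'v measure" and V :: "real \<Rightarrow> 'v \<Rightarrow> complex"
  assumes "positive_semidefinite (vector [vector [a, c], vector [c, b]])"
    and "complex_brownian_motion M (vector [vector [a, c], vector [c, b]]) U"
    and "complex_brownian_motion N (vector [vector [b, - c], vector [- c, a]]) V"
    and "t > 0"
  shows "eq_in_law partial_map_space
           M (\<lambda>\<omega> z. map_option (\<lambda>w. \<i> * w)
                      (map_inverse (centered_loewner_map (\<lambda>s. U s \<omega>) t) (- \<i> * z)))
           N (\<lambda>\<omega>. centered_loewner_map (\<lambda>s. V s \<omega>) t)
       \<and> eq_in_law closed_set_space
           N (\<lambda>\<omega>. left_hull (\<lambda>s. V s \<omega>) t)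
           M (\<lambda>\<omega>. (\<lambda>z. \<i> * z) ` right_hull (\<lambda>s. U s \<omega>) t)
       \<and> eq_in_law closed_set_space
           N (\<lambda>\<omega>. right_hull (\<lambda>s. V s \<omega>) t)
           M (\<lambda>\<omega>. (\<lambda>z. \<i> * z) ` left_hull (\<lambda>s. U s \<omega>) t)"
proof -
  have t: "0 \<le> t" using assms(4) by simp
  define W where "W = (\<lambda>\<omega>. reversed_driver t (\<lambda>r. U r \<omega>))"
  interpret M: prob_space M using assms(2) by (simp add: complex_brownian_motion_def)
  interpret U: continuous_driver M U t by (rule continuous_driver_brownian[OF assms(2) t])
  interpret V: continuous_driver N V t by (rule continuous_driver_brownian[OF assms(3) t])
  interpret W: continuous_driver M "\<lambda>s \<omega>. W \<omega> s" t
    unfolding W_def by (rule U.continuous_driver_reversed)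
  interpret path: continuous_driver "path_space t" "\<lambda>s u. u s" t
    by (rule continuous_driver_path_space[OF t])
  have U0: "AE \<omega> in M. U 0 \<omega> = 0" using assms(2) by (simp add: complex_brownian_motion_def)
  have "distr M (PiM {0..t} (\<lambda>_. borel)) (\<lambda>\<omega>. \<lambda>s\<in>{0..t}. W \<omega> s)
      = distr N (PiM {0..t} (\<lambda>_. borel)) (\<lambda>\<omega>. \<lambda>s\<in>{0..t}. V s \<omega>)"
    unfolding W_def
  proof (rule independent_increments_law_unique)
    show "prob_space M" "prob_space N"
      using assms(2,3) by (simp_all add: complex_brownian_motion_def)
  qed (fact assms(4) independent_increments_reversed_driver[OF assms(2) t]
        independent_increments_brownian[OF assms(3) t] reversed_brownian_increment_law[OF assms(2,3)])+
  note law = distr_path_functional_eq[OF W.continuous_driver_axioms V.continuous_driver_axioms this]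
  have "eq_in_law partial_map_space
      M (\<lambda>\<omega> z. map_option (\<lambda>w. \<i> * w) (map_inverse (centered_loewner_map (\<lambda>s. U s \<omega>) t) (- \<i> * z)))
      N (\<lambda>\<omega>. centered_loewner_map (\<lambda>s. V s \<omega>) t)" (is "eq_in_law _ _ ?X _ ?Y")
  proof -
    have X: "?X \<omega> = (\<lambda>z. map_option (\<lambda>w. w + \<i> * U 0 \<omega>) (centered_loewner_map (W \<omega>) t z))"
      if "\<omega> \<in> space M" for \<omega>
      unfolding W_def by (rule ext) (rule map_inverse_reversed_driver[OF U.continuous_path[OF that] t])
    have "(\<lambda>\<omega>. \<i> * U 0 \<omega>) \<in> borel_measurable M"
      using U.measurable_driver[of 0] t by simp
    from W.measurable_shifted_centered_loewner_map[OF this]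
    have Xm: "?X \<in> measurable M partial_map_space"
      by (rule measurable_cong[THEN iffD1, rotated]) (rule X[symmetric])
    \<comment> \<open>With measurability settled at every outcome, the translation may now be
      dropped on the almost sure event \<open>U 0 = 0\<close>.\<close>
    have "distr M partial_map_space ?X = distr M partial_map_space (\<lambda>\<omega>. centered_loewner_map (W \<omega>) t)"
    proof (rule distr_cong_AE[OF refl refl _ Xm W.measurable_centered_loewner_map])
      show "AE \<omega> in M. ?X \<omega> = centered_loewner_map (W \<omega>) t"
        using U0
      proof (rule AE_mp, intro AE_I2 impI)
        fix \<omega> assume "\<omega> \<in> space M" "U 0 \<omega> = 0"
        then show "?X \<omega> = centered_loewner_map (W \<omega>) t" unfolding X[OF \<open>\<omega> \<in> space M\<close>]
          by (simp add: option.map_ident)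
      qed
    qed
    also have "\<dots> = distr N partial_map_space ?Y"
      by (rule law[OF path.measurable_centered_loewner_map])
    finally show ?thesis
      using Xm V.measurable_centered_loewner_map by (simp add: eq_in_law_def)
  qed
  moreover have "eq_in_law closed_set_space
      N (\<lambda>\<omega>. left_hull (\<lambda>s. V s \<omega>) t) M (\<lambda>\<omega>. (*) \<i> ` right_hull (\<lambda>s. U s \<omega>) t)"
  proof -
    have "(*) \<i> ` right_hull (\<lambda>s. U s \<omega>) t = left_hull (W \<omega>) t" if "\<omega> \<in> space M" for \<omega>
      unfolding W_def by (rule right_hull_reversed_driver[OF U.continuous_path[OF that] t])
    then have "distr M closed_set_space (\<lambda>\<omega>. (*) \<i> ` right_hull (\<lambda>s. U s \<omega>) t)
        = distr M closed_set_space (\<lambda>\<omega>. left_hull (W \<omega>) t)"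
      by (intro distr_cong) auto
    then show ?thesis
      using V.measurable_left_hull law[OF path.measurable_left_hull]
        measurable_compose[OF U.measurable_right_hull measurable_closed_set_image, of \<i>]
      by (simp add: eq_in_law_def)
  qed
  moreover have "eq_in_law closed_set_space
      N (\<lambda>\<omega>. right_hull (\<lambda>s. V s \<omega>) t) M (\<lambda>\<omega>. (*) \<i> ` left_hull (\<lambda>s. U s \<omega>) t)"
  proof -
    have Lm: "(\<lambda>\<omega>. (*) \<i> ` left_hull (\<lambda>s. U s \<omega>) t) \<in> measurable M closed_set_space"
      by (rule measurable_compose[OF U.measurable_left_hull measurable_closed_set_image]) simp
    \<comment> \<open>For this hull the identity with the reversed chain holds where
      \<open>U 0 = 0\<close>, so the laws are compared almost everywhere.\<close>
    have "distr M closed_set_space (\<lambda>\<omega>. (*) \<i> ` left_hull (\<lambda>s. U s \<omega>) t)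
        = distr M closed_set_space (\<lambda>\<omega>. right_hull (W \<omega>) t)"
    proof (rule distr_cong_AE[OF refl refl _ Lm W.measurable_right_hull])
      show "AE \<omega> in M. (*) \<i> ` left_hull (\<lambda>s. U s \<omega>) t = right_hull (W \<omega>) t"
        using U0 unfolding W_def
        by (rule AE_mp) (auto intro!: AE_I2 left_hull_reversed_driver[OF U.continuous_path t])
    qed
    then show ?thesis
      using V.measurable_right_hull Lm law[OF path.measurable_right_hull] by (simp add: eq_in_law_def)
  qed
  ultimately show ?thesis by blast
qed

end
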